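(* Let $d\ge 3$ and let $S=\{(\omega,\xi)\in\mathbb{R}\times\mathbb{R}^d : \omega=-|\xi|^2\}$ be the paraboloid in $\mathbb{R}^{d+1}$. Then, for every non-zero $W\in L^d_x(\mathbb{R}^d)$ (complex-valued), identified with the time-independent function $W(t,x)=W(x)$ on $\mathbb{R}\times\mathbb{R}^d$, the bounded operator $\overline{W}\,T_S\,W$ on $L^2(\mathbb{R}^{d+1})$ is not compact.
   Context: The paraboloid $S$ is endowed with the measure obtained by pushing forward the Lebesgue measure of $\mathbb{R}^d$ under $\xi\mapsto(-|\xi|^2,\xi)$, so that $L^2(S)\simeq L^2(\mathbb{R}^d)$ isometrically. The restriction operator $\mathcal{R}_S$ sends a function $F(t,x)$ on $\mathbb{R}\times\mathbb{R}^d$ to the restriction of its space-time Fourier transform to $S$: $$(\mathcal{R}_SF)(\xi)=\int_{\mathbb{R}}\int_{\mathbb{R}^d}e^{-i(x\cdot\xi-t|\xi|^2)}F(t,x)\,dx\,dt .$$ Its formal adjoint is $((\mathcal{R}_S)^*g)(t,x)=\int_{\mathbb{R}^d}e^{i(x\cdot\xi-t|\xi|^2)}g(\xi)\,d\xi$, and $T_S:=(\mathcal{R}_S)^*\mathcal{R}_S$; equivalently, up to a positive constant depending only on $d$ and the normalization of the Fourier transform, $(T_SF)(t,\cdot)=\int_{\mathbb{R}}e^{i(t-s)\Delta_x}F(s,\cdot)\,ds$. The functions $W$ and $\overline{W}$ (complex conjugate) are viewed as multiplication operators, so $\overline{W}T_SW$ denotes $F\mapsto\overline{W}\,T_S(WF)$.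 For $W\in L^d_x(\mathbb{R}^d)$, $d\ge3$, the operator $\mathcal{R}_SW: F\mapsto\mathcal{R}_S(WF)$ is bounded from $L^2(\mathbb{R}^{d+1})$ to $L^2(\mathbb{R}^d)$ by the (dual) Keel–Tao endpoint Strichartz estimate, since $WF\in L^2_tL^{2d/(d+2)}_x$; thus $\overline{W}T_SW=(\mathcal{R}_SW)^*(\mathcal{R}_SW)$ is a well-defined bounded operator on $L^2(\mathbb{R}^{d+1})$. *)

theory Defs
  imports "HOL-Analysis.Analysis"
begin

text \<open>
  Elements of \<open>L\<^sup>2\<close> are represented by Borel functions; all notions below are invariant under
  changing representatives on Lebesgue null sets.
\<close>

definition L2 :: "('a::euclidean_space \<Rightarrow> complex) set" where
  "L2 = {f \<in> borel_measurable lborel. integrable lborel (\<lambda>x. (norm (f x))\<^sup>2)}"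

definition L2_norm :: "('a::euclidean_space \<Rightarrow> complex) \<Rightarrow> real" where
  "L2_norm f = sqrt (LINT x|lborel. (norm (f x))\<^sup>2)"

definition L2_inner :: "('a::euclidean_space \<Rightarrow> complex) \<Rightarrow> ('a \<Rightarrow> complex) \<Rightarrow> complex" where
  "L2_inner f g = (LINT x|lborel. f x * cnj (g x))"

definition L2_tendsto :: "(nat \<Rightarrow> 'a::euclidean_space \<Rightarrow> complex) \<Rightarrow> ('a \<Rightarrow> complex) \<Rightarrow> bool" where
  "L2_tendsto f g \<longleftrightarrow> (\<lambda>n. L2_norm (\<lambda>x. f n x - g x)) \<longlonglongrightarrow> 0"

lemma borel_measurable_cnj [measurable (raw)]:
  "f \<in> borel_measurable M \<Longrightarrow> (\<lambda>x. cnj (f x)) \<in> borel_measurable M"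
  by (rule borel_measurable_continuous_on[where f = cnj]) (auto intro: continuous_intros)

lemma L2_inner_integrable:
  assumes "f \<in> L2" "g \<in> L2"
  shows "integrable lborel (\<lambda>x. f x * cnj (g x))"
proof (rule Bochner_Integration.integrable_bound)
  show "integrable lborel (\<lambda>x. (norm (f x))\<^sup>2 + (norm (g x))\<^sup>2)"
    using assms by (auto simp: L2_def)
  show "(\<lambda>x. f x * cnj (g x)) \<in> borel_measurable lborel"
    using assms by (auto simp: L2_def)
  show "AE x in lborel. norm (f x * cnj (g x)) \<le> norm ((norm (f x))\<^sup>2 + (norm (g x))\<^sup>2)"
  proof (rule AE_I2)
    fix x
    have "2 * (norm (f x) * norm (g x)) \<le> (norm (f x))\<^sup>2 + (norm (g x))\<^sup>2"
      using sum_squares_bound[of "norm (f x)" "norm (g x)"] by (simp add: mult.assoc)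
    moreover have "0 \<le> norm (f x) * norm (g x)" by simp
    ultimately have "norm (f x) * norm (g x) \<le> (norm (f x))\<^sup>2 + (norm (g x))\<^sup>2" by linarith
    then show "norm (f x * cnj (g x)) \<le> norm ((norm (f x))\<^sup>2 + (norm (g x))\<^sup>2)"
      by (simp add: norm_mult)
  qed
qed

lemma L2_diff:
  assumes "f \<in> L2" "g \<in> L2"
  shows "(\<lambda>x. f x - g x) \<in> L2"
proof -
  have "integrable lborel (\<lambda>x. (norm (f x - g x))\<^sup>2)"
  proof (rule Bochner_Integration.integrable_bound)
    show "integrable lborel (\<lambda>x. 2 * (norm (f x))\<^sup>2 + 2 * (norm (g x))\<^sup>2)"
      using assms by (auto simp: L2_def)
    show "(\<lambda>x. (norm (f x - g x))\<^sup>2) \<in> borel_measurable lborel"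
      using assms by (auto simp: L2_def)
    show "AE x in lborel. norm ((norm (f x - g x))\<^sup>2) \<le> norm (2 * (norm (f x))\<^sup>2 + 2 * (norm (g x))\<^sup>2)"
    proof (rule AE_I2)
      fix x
      have "(norm (f x - g x))\<^sup>2 \<le> (norm (f x) + norm (g x))\<^sup>2"
        by (rule power_mono) (auto intro: norm_triangle_ineq4)
      also have "\<dots> \<le> 2 * (norm (f x))\<^sup>2 + 2 * (norm (g x))\<^sup>2"
        using sum_squares_bound[of "norm (f x)" "norm (g x)"] by (simp add: power2_sum)
      finally show "norm ((norm (f x - g x))\<^sup>2) \<le> norm (2 * (norm (f x))\<^sup>2 + 2 * (norm (g x))\<^sup>2)"
        by simp
    qed
  qed
  then show ?thesis using assms by (auto simp: L2_def)
qed

lemma L2_Cauchy_Schwarz: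
  assumes "f \<in> L2" "g \<in> L2"
  shows "norm (L2_inner f g) \<le> L2_norm f * L2_norm g"
proof -
  define A where "A = (LINT x|lborel. (norm (f x))\<^sup>2)"
  define B where "B = (LINT x|lborel. (norm (g x))\<^sup>2)"
  define C where "C = norm (L2_inner f g)"
  have A0: "A \<ge> 0" and B0: "B \<ge> 0" and C0: "C \<ge> 0" by (auto simp: A_def B_def C_def)
  have i: "integrable lborel (\<lambda>x. (norm (f x))\<^sup>2)" "integrable lborel (\<lambda>x. (norm (g x))\<^sup>2)"
    using assms by (auto simp: L2_def)
  have key: "2 * s * C \<le> s\<^sup>2 * A + B" if "s \<ge> 0" for s
  proof -
    have "2 * s * C \<le> 2 * s * (LINT x|lborel. norm (f x * cnj (g x)))"
      unfolding C_def L2_inner_def using that by (intro mult_left_mono) auto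
    also have "\<dots> = (LINT x|lborel. 2 * s * norm (f x * cnj (g x)))" by simp
    also have "\<dots> \<le> (LINT x|lborel. s\<^sup>2 * (norm (f x))\<^sup>2 + (norm (g x))\<^sup>2)"
    proof (rule integral_mono)
      show "integrable lborel (\<lambda>x. 2 * s * norm (f x * cnj (g x)))"
        using L2_inner_integrable[OF assms] by auto
      show "integrable lborel (\<lambda>x. s\<^sup>2 * (norm (f x))\<^sup>2 + (norm (g x))\<^sup>2)" using i by auto
      show "2 * s * norm (f x * cnj (g x)) \<le> s\<^sup>2 * (norm (f x))\<^sup>2 + (norm (g x))\<^sup>2" for x
        using sum_squares_bound[of "s * norm (f x)" "norm (g x)"]
        by (simp add: norm_mult power_mult_distrib mult.assoc)
    qed
    also have "\<dots> = s\<^sup>2 * A + B" using i by (simp add: A_def B_def)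
    finally show ?thesis .
  qed
  have "C\<^sup>2 \<le> A * B"
  proof (cases "A = 0")
    case True
    have "C = 0"
    proof (rule ccontr)
      assume "C \<noteq> 0"
      then have "C > 0" using C0 by simp
      have "2 * (B / C + 1) * C \<le> B" using key[of "B / C + 1"] True B0 C0 by simp
      then show False using \<open>C > 0\<close> B0 mult_nonneg_nonneg[OF B0 C0] mult_pos_pos[OF \<open>C > 0\<close> \<open>C > 0\<close>]
        by (simp add: field_simps)
    qed
    then show ?thesis using True by simp
  next
    case False
    then have "A > 0" using A0 by simp
    have "2 * (C / A) * C \<le> (C / A)\<^sup>2 * A + B" using key[of "C / A"] A0 C0 by simp
    then show ?thesis using \<open>A > 0\<close> by (simp add: field_simps power2_eq_square)
  qed
  then have "C \<le> sqrt (A * B)" by (rule real_le_rsqrt)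
  then show ?thesis by (simp add: C_def A_def B_def L2_norm_def real_sqrt_mult)
qed

lemma L2_inner_tendsto:
  assumes "\<And>n. f n \<in> L2" "f0 \<in> L2" "g \<in> L2" "L2_tendsto f f0"
  shows "(\<lambda>n. L2_inner (f n) g) \<longlonglongrightarrow> L2_inner f0 g"
proof (rule Lim_null[THEN iffD2], rule Lim_null_comparison)
  show "\<forall>\<^sub>F n in sequentially. norm (L2_inner (f n) g - L2_inner f0 g)
          \<le> L2_norm (\<lambda>x. f n x - f0 x) * L2_norm g"
  proof (rule always_eventually, rule allI)
    fix n
    have "L2_inner (f n) g - L2_inner f0 g = L2_inner (\<lambda>x. f n x - f0 x) g"
      using L2_inner_integrable[OF assms(1)[of n] assms(3)] L2_inner_integrable[OF assms(2,3)]
      by (simp add: L2_inner_def algebra_simps)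
    then show "norm (L2_inner (f n) g - L2_inner f0 g) \<le> L2_norm (\<lambda>x. f n x - f0 x) * L2_norm g"
      using L2_Cauchy_Schwarz[OF L2_diff[OF assms(1)[of n] assms(2)] assms(3)] by simp
  qed
  show "(\<lambda>n. L2_norm (\<lambda>x. f n x - f0 x) * L2_norm g) \<longlonglongrightarrow> 0"
    using assms(4) by (auto simp: L2_tendsto_def intro: tendsto_mult_left_zero)
qed

text \<open>
  Operators between \<open>L\<^sup>2\<close> spaces are represented by their graphs
  (the closures and adjoints below contain with a pair of functions every pair of almost
  everywhere equal \<open>L\<^sup>2\<close> functions).
\<close>

type_synonym ('a, 'b) L2_op = "(('a \<Rightarrow> complex) \<times> ('b \<Rightarrow> complex)) set"

definition L2_closure ::
  "('a::euclidean_space, 'b::euclidean_space) L2_op \<Rightarrow> ('a, 'b) L2_op" where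
  "L2_closure A = {(F, f). F \<in> L2 \<and> f \<in> L2 \<and>
     (\<exists>Fs fs. (\<forall>n. (Fs n, fs n) \<in> A) \<and> L2_tendsto Fs F \<and> L2_tendsto fs f)}"

definition L2_adjoint ::
  "('a::euclidean_space, 'b::euclidean_space) L2_op \<Rightarrow> ('b, 'a) L2_op" where
  "L2_adjoint A = {(g, H). g \<in> L2 \<and> H \<in> L2 \<and>
     (\<forall>(F, f) \<in> A. L2_inner f g = L2_inner F H)}"

text \<open>
  For an everywhere defined operator this is the usual notion: every bounded sequence has
  a subsequence along which the values converge.
  Nothing is required of arguments outside the domain, so the negation of this property
  provides an actual bounded sequence in the domain whose values have no convergent subsequence.
\<close>

definition L2_compact :: "('a::euclidean_space, 'b::euclidean_space) L2_op \<Rightarrow> bool" where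
  "L2_compact A \<longleftrightarrow>
     (\<forall>Fs Hs. (\<forall>n. (Fs n, Hs n) \<in> A) \<and> (\<exists>C. \<forall>n. L2_norm (Fs n) \<le> C) \<longrightarrow>
        (\<exists>r H. strict_mono (r :: nat \<Rightarrow> nat) \<and> H \<in> L2 \<and> L2_tendsto (\<lambda>n. Hs (r n)) H))"

definition spacetime_fourier ::
  "(real \<times> (real ^ 'n) \<Rightarrow> complex) \<Rightarrow> real \<times> (real ^ 'n) \<Rightarrow> complex" where
  "spacetime_fourier F = (\<lambda>(\<omega>, \<xi>).
     LINT t|lborel. LINT x|lborel. cis (- (t * \<omega> + x \<bullet> \<xi>)) * F (t, x))"

definition paraboloid :: "(real \<times> (real ^ 'n)) set" where
  "paraboloid = {(\<omega>, \<xi>). \<omega> = - (norm \<xi>)\<^sup>2}"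

text \<open>
  Functions on the paraboloid are identified with functions of \<open>\<xi>\<close> via this parametrization; the
  measure on the paraboloid is the push-forward of Lebesgue measure, so that \<open>L\<^sup>2\<close> of the
  paraboloid is \<open>L\<^sup>2\<close> of \<open>\<xi>\<close>-space.
\<close>

definition paraboloid_param :: "real ^ 'n \<Rightarrow> real \<times> (real ^ 'n)" where
  "paraboloid_param \<xi> = (- (norm \<xi>)\<^sup>2, \<xi>)"

lemma bij_betw_paraboloid_param: "bij_betw paraboloid_param UNIV paraboloid"
  by (rule bij_betw_byWitness[where f' = snd])
     (auto simp: paraboloid_param_def paraboloid_def)

definition restr :: "(real \<times> (real ^ 'n) \<Rightarrow> complex) \<Rightarrow> real ^ 'n \<Rightarrow> complex" where
  "restr F \<xi> = spacetime_fourier F (paraboloid_param \<xi>)"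

lemma restr_eq:
  "restr F \<xi> =
     (LINT t|lborel. LINT x|lborel. cis (- (x \<bullet> \<xi> - t * (norm \<xi>)\<^sup>2)) * F (t, x))"
  by (simp add: restr_def spacetime_fourier_def paraboloid_param_def algebra_simps)

definition restr_adj :: "(real ^ 'n \<Rightarrow> complex) \<Rightarrow> real \<times> (real ^ 'n) \<Rightarrow> complex" where
  "restr_adj g = (\<lambda>(t, x). LINT \<xi>|lborel. cis (x \<bullet> \<xi> - t * (norm \<xi>)\<^sup>2) * g \<xi>)"

definition TS :: "(real \<times> (real ^ 'n) \<Rightarrow> complex) \<Rightarrow> real \<times> (real ^ 'n) \<Rightarrow> complex" where
  "TS F = restr_adj (restr F)"

lemma restr_duality:
  fixes G :: "real \<times> (real ^ 'n) \<Rightarrow> complex"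
  assumes G: "integrable lborel G" and g: "integrable lborel g"
  shows "L2_inner (restr G) g = (LINT z|lborel. G z * cnj (restr_adj g z))"
proof -
  define e :: "real \<times> (real ^ 'n) \<Rightarrow> real ^ 'n \<Rightarrow> complex" where
    "e z \<xi> = cis (- (snd z \<bullet> \<xi> - fst z * (norm \<xi>)\<^sup>2))" for z \<xi>
  have [measurable]: "G \<in> borel_measurable borel" "g \<in> borel_measurable borel"
    using G g by (auto dest: borel_measurable_integrable)
  have e_m: "(\<lambda>p. e (fst p) (snd p)) \<in> borel_measurable (borel \<Otimes>\<^sub>M borel)"
    unfolding e_def borel_prod cis_conv_exp
    by (intro borel_measurable_continuous_onI continuous_intros)
  have e_m1: "(\<lambda>z. e z \<xi>) \<in> borel_measurable borel" for \<xi>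
    unfolding e_def cis_conv_exp by (intro borel_measurable_continuous_onI continuous_intros)
  have ne: "norm (e z \<xi>) = 1" for z \<xi> by (simp add: e_def)
  have eG: "integrable lborel (\<lambda>z. e z \<xi> * G z)" for \<xi>
    by (rule Bochner_Integration.integrable_bound[OF G]) (use e_m1 in \<open>auto simp: norm_mult ne\<close>)
  have r: "restr G \<xi> = (LINT z|lborel. e z \<xi> * G z)" for \<xi>
    using lborel_pair.integral_fst'[of "\<lambda>z. e z \<xi> * G z"] eG[of \<xi>]
    by (simp add: restr_eq e_def lborel_prod)
  have GG: "integrable (lborel \<Otimes>\<^sub>M lborel) (\<lambda>(z, \<xi>). G z * cnj (g \<xi>))"
  proof (rule lborel_pair.Fubini_integrable)
    show "(\<lambda>(z, \<xi>). G z * cnj (g \<xi>)) \<in> borel_measurable (lborel \<Otimes>\<^sub>M lborel)" by measurable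
    show "integrable lborel (\<lambda>x. LINT y|lborel. norm (case (x, y) of (z, \<xi>) \<Rightarrow> G z * cnj (g \<xi>)))"
      using G by (auto simp: norm_mult)
    show "AE x in lborel. integrable lborel (\<lambda>y. case (x, y) of (z, \<xi>) \<Rightarrow> G z * cnj (g \<xi>))"
      using g by auto
  qed
  have I: "integrable (lborel \<Otimes>\<^sub>M lborel) (\<lambda>(z, \<xi>). e z \<xi> * (G z * cnj (g \<xi>)))"
    by (rule Bochner_Integration.integrable_bound[OF GG])
       (use e_m in \<open>auto simp: norm_mult ne split_beta\<close>)
  have "L2_inner (restr G) g = (LINT \<xi>|lborel. LINT z|lborel. e z \<xi> * (G z * cnj (g \<xi>)))"
    by (simp add: L2_inner_def r mult.assoc[symmetric])
  also have "\<dots> = (LINT z|lborel. LINT \<xi>|lborel. e z \<xi> * (G z * cnj (g \<xi>)))"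
    by (rule lborel_pair.Fubini_integral[OF I])
  also have "\<dots> = (LINT z|lborel. G z * (LINT \<xi>|lborel. e z \<xi> * cnj (g \<xi>)))"
    by (simp add: mult.left_commute)
  also have "(\<lambda>z. LINT \<xi>|lborel. e z \<xi> * cnj (g \<xi>)) = (\<lambda>z. cnj (restr_adj g z))"
  proof
    fix z :: "real \<times> (real ^ 'n)"
    have "cnj (restr_adj g z) = (LINT \<xi>|lborel. cnj (cis (snd z \<bullet> \<xi> - fst z * (norm \<xi>)\<^sup>2) * g \<xi>))"
      by (simp only: restr_adj_def split_beta Bochner_Integration.integral_cnj)
    then show "(LINT \<xi>|lborel. e z \<xi> * cnj (g \<xi>)) = cnj (restr_adj g z)"
      by (simp add: e_def cis_cnj)
  qed
  finally show ?thesis by meson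
qed

definition time_indep :: "(real ^ 'n \<Rightarrow> complex) \<Rightarrow> real \<times> (real ^ 'n) \<Rightarrow> complex" where
  "time_indep W = (\<lambda>(t, x). W x)"

text \<open>
  The integral defining the restriction of \<open>W F\<close> need not converge for a general \<open>F\<close> in \<open>L\<^sup>2\<close>.
  As usual, the operator \<open>F \<mapsto> restr (W F)\<close> on \<open>L\<^sup>2\<close> is the extension by continuity from the dense
  subspace of those \<open>F\<close> for which \<open>W F\<close> is integrable. If \<open>\<bar>W\<bar>\<^sup>d\<close> is integrable, \<open>d \<ge> 3\<close>, then this
  extension is a bounded operator on all of \<open>L\<^sup>2\<close> (endpoint Strichartz estimate).
\<close>

definition restr_mult ::
  "(real ^ 'n \<Rightarrow> complex) \<Rightarrow> (real \<times> (real ^ 'n), real ^ 'n) L2_op" where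
  "restr_mult W = L2_closure
     {(F, restr (\<lambda>z. time_indep W z * F z) :: real ^ 'n \<Rightarrow> complex) | F.
        F \<in> L2 \<and> integrable lborel (\<lambda>z. time_indep W z * F z) \<and>
        restr (\<lambda>z. time_indep W z * F z) \<in> L2}"

text \<open>
  The operator \<open>F \<mapsto> cnj W \<cdot> TS (W F)\<close> on \<open>L\<^sup>2\<close>, as the composition of \<open>restr_mult W\<close> with its
  adjoint (\<open>O\<close> applies its left argument first). It is given by the integral formula
  whenever the integrals converge absolutely; see \<open>sandwiched_TS_eq\<close>.
\<close>

definition sandwiched_TS ::
  "(real ^ 'n \<Rightarrow> complex) \<Rightarrow> (real \<times> (real ^ 'n), real \<times> (real ^ 'n)) L2_op" where
  "sandwiched_TS W = restr_mult W O L2_adjoint (restr_mult W)"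

lemma sandwiched_TS_eq:
  fixes W :: "real ^ 'n \<Rightarrow> complex" and F :: "real \<times> (real ^ 'n) \<Rightarrow> complex"
  defines "H \<equiv> \<lambda>z. cnj (time_indep W z) * TS (\<lambda>z. time_indep W z * F z) z"
  assumes "F \<in> L2" "integrable lborel (\<lambda>z. time_indep W z * F z)"
    and "restr (\<lambda>z. time_indep W z * F z) \<in> L2"
    and "integrable lborel (restr (\<lambda>z. time_indep W z * F z))"
    and "H \<in> L2"
  shows "(F, H) \<in> sandwiched_TS W"
proof -
  define m where "m F z = time_indep W z * F z" for F z
  note m = m_def[abs_def]
  define g where "g = restr (m F)"
  have 0: "L2_norm (\<lambda>x::'a::euclidean_space. 0) = 0" by (simp add: L2_norm_def)
  have 1: "(F, g) \<in> restr_mult W"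
    unfolding restr_mult_def L2_closure_def
    using assms by (auto simp: g_def m L2_tendsto_def 0 intro!: exI[of _ "\<lambda>_. F"] exI[of _ "\<lambda>_. g"])
  have g: "g \<in> L2" "integrable lborel g" using assms by (auto simp: g_def m)
  have core: "L2_inner (restr (m F')) g = L2_inner F' H" if "integrable lborel (m F')" for F'
    using restr_duality[OF that g(2)]
    by (simp add: L2_inner_def H_def TS_def m g_def mult_ac)
  have "L2_inner f' g = L2_inner F' H" if F': "(F', f') \<in> restr_mult W" for F' f'
  proof -
    obtain Fs where Fs: "F' \<in> L2" "f' \<in> L2" "\<And>n. Fs n \<in> L2" "\<And>n. integrable lborel (m (Fs n))"
      "\<And>n. restr (m (Fs n)) \<in> L2" "L2_tendsto Fs F'" "L2_tendsto (\<lambda>n. restr (m (Fs n))) f'"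
    proof -
      obtain Fs fs where *: "F' \<in> L2" "f' \<in> L2" "L2_tendsto Fs F'" "L2_tendsto fs f'"
        "\<And>n. Fs n \<in> L2 \<and> integrable lborel (m (Fs n)) \<and> restr (m (Fs n)) \<in> L2 \<and> fs n = restr (m (Fs n))"
        using F' unfolding restr_mult_def L2_closure_def m by blast
      then have "fs = (\<lambda>n. restr (m (Fs n)))" by auto
      then show thesis using that[of Fs] * by auto
    qed
    have "(\<lambda>n. L2_inner (restr (m (Fs n))) g) \<longlonglongrightarrow> L2_inner f' g"
      by (rule L2_inner_tendsto) (use Fs g in auto)
    moreover have "(\<lambda>n. L2_inner (Fs n) H) \<longlonglongrightarrow> L2_inner F' H"
      by (rule L2_inner_tendsto) (use Fs assms in auto)
    ultimately show ?thesis using core[OF Fs(4)] LIMSEQ_unique by auto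
  qed
  then have "(g, H) \<in> L2_adjoint (restr_mult W)"
    using g assms by (auto simp: L2_adjoint_def)
  with 1 show ?thesis by (auto simp: sandwiched_TS_def)
qed

end

theory Submission
  imports
    Defs
    "HOL-Probability.Characteristic_Functions"
    "HOL-Probability.Sinc_Integral"
    "HOL-Real_Asymp.Real_Asymp"
begin

text \<open>
  The operator commutes with translations in time, because \<open>W\<close> does not depend on time, and such
  an operator cannot be compact unless it vanishes. It therefore suffices to find one input
  \<open>F\<close> in \<open>L\<^sup>2\<close> whose output \<open>H\<close> is in \<open>L\<^sup>2\<close>, is not zero, and can be computed well enough to see that
  its translates \<open>H(t - n, x)\<close> tend to \<open>0\<close> pointwise. If a subsequence of these translates converged in
  \<open>L\<^sup>2\<close>, then its limit would be \<open>0\<close> (\<open>L2_tendsto_pointwise_zero\<close>), although all of them have the same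
  positive norm.

  Let \<open>A\<close> be a bounded set of positive measure on which \<open>\<bar>W\<bar>\<close> is bounded below, and let
  \<open>F(t, x) = 1\<^sub>A(x) / (W(x) (1 + t\<^sup>2))\<close>. Then \<open>W F = 1\<^sub>A(x) / (1 + t\<^sup>2)\<close>. The Fourier transform of
  \<open>1/(1 + t\<^sup>2)\<close> is \<open>\<pi> e\<^bsup>-\<bar>\<omega>\<bar>\<^esup>\<close>, and its value at \<open>\<omega> = -\<bar>\<xi>\<bar>\<^sup>2\<close> is a Gaussian in \<open>\<xi>\<close>. Thus the restriction of
  \<open>W F\<close> to the paraboloid is \<open>\<pi> e\<^bsup>-\<bar>\<xi>\<bar>\<^sup>2\<^esup>\<close> times the Fourier transform of \<open>1\<^sub>A\<close> (\<open>restr_source\<close>), and its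
  extension to space-time is, up to a constant, \<open>e\<^bsup>(1+it)\<Delta>\<^esup> 1\<^sub>A\<close>: a superposition of Gaussian packets of
  width comparable to \<open>T = \<surd>(1 + t\<^sup>2)\<close> and height \<open>T\<^bsup>-d/2\<^esup>\<close> (\<open>norm_schroedinger_kernel_sq\<close>). This explicit decay
  gives the pointwise convergence of the translates and, with \<open>W\<close> in \<open>L\<^sup>d\<close>, square integrability of \<open>H\<close>
  (\<open>weighted_wave_in_L2\<close>). Finally \<open>H \<noteq> 0\<close> since
  \<open>\<langle>F, H\<rangle>\<close> is the squared norm of the restriction of \<open>W F\<close> (\<open>weighted_wave_nonzero\<close>).
\<close>

section \<open>Integrals over product spaces\<close>

lemma
  fixes f :: "'a::euclidean_space \<Rightarrow> real \<Rightarrow> 'c::{real_normed_field,banach,second_countable_topology}"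
  assumes f: "\<And>b. b \<in> Basis \<Longrightarrow> integrable lborel (f b)"
  shows integrable_lborel_prod: "integrable lborel (\<lambda>x::'a. \<Prod>b\<in>Basis. f b (x \<bullet> b))"
    and integral_lborel_prod: "(LINT x|lborel. (\<Prod>b\<in>Basis. f b ((x::'a) \<bullet> b))) = (\<Prod>b\<in>Basis. (LINT s|lborel. f b s))"
proof -
  interpret product_sigma_finite "\<lambda>b::'a. lborel :: real measure" ..
  let ?\<Pi> = "Pi\<^sub>M (Basis::'a set) (\<lambda>_. lborel :: real measure)"
  let ?T = "\<lambda>g. \<Sum>b\<in>Basis. g b *\<^sub>R (b::'a)"
  have [measurable]: "f b \<in> borel_measurable borel" if "b \<in> Basis" for b
    using f[OF that] by (auto dest: borel_measurable_integrable)
  have T: "?T \<in> measurable ?\<Pi> borel"  by measurable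
  have m: "(\<lambda>x::'a. \<Prod>b\<in>Basis. f b (x \<bullet> b)) \<in> borel_measurable borel" by measurable
  have eq: "(\<Prod>b\<in>Basis. f b (?T g \<bullet> b)) = (\<Prod>b\<in>Basis. f b (g b))" for g
    by (intro prod.cong refl) (simp add: inner_sum_left inner_Basis if_distrib sum.delta cong: if_cong)
  show "integrable lborel (\<lambda>x::'a. \<Prod>b\<in>Basis. f b (x \<bullet> b))"
    by (subst lborel_eq, subst integrable_distr_eq[OF T m], unfold eq) (intro product_integrable_prod f, auto)
  show "(LINT x|lborel. (\<Prod>b\<in>Basis. f b ((x::'a) \<bullet> b))) = (\<Prod>b\<in>Basis. (LINT s|lborel. f b s))"
    by (subst lborel_eq, subst integral_distr[OF T m], unfold eq) (intro product_integral_prod f, auto)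
qed

lemma integrable_tensor:
  fixes f :: "'a::euclidean_space \<Rightarrow> 'c::{real_normed_field,banach,second_countable_topology}"
    and g :: "'b::euclidean_space \<Rightarrow> 'c"
  assumes f: "integrable lborel f" and g: "integrable lborel g"
  shows "integrable lborel (\<lambda>z. f (fst z) * g (snd z))"
proof -
  have [measurable]: "f \<in> borel_measurable borel" "g \<in> borel_measurable borel"
    using f g by (auto dest: borel_measurable_integrable)
  have "integrable (lborel \<Otimes>\<^sub>M lborel) (\<lambda>z. f (fst z) * g (snd z))"
  proof (rule lborel_pair.Fubini_integrable)
    show "(\<lambda>z. f (fst z) * g (snd z)) \<in> borel_measurable (lborel \<Otimes>\<^sub>M lborel)" by measurable
    show "integrable lborel (\<lambda>x. LINT y|lborel. norm (f (fst (x, y)) * g (snd (x, y))))"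
      using f by (simp add: norm_mult)
    show "AE x in lborel. integrable lborel (\<lambda>y. f (fst (x, y)) * g (snd (x, y)))"
      using g by simp
  qed
  then show ?thesis by (simp add: lborel_prod)
qed

section \<open>Gaussian integrals\<close>

lemma cis_measurable [measurable]: "cis \<in> borel_measurable borel"
  unfolding cis_conv_exp by (intro borel_measurable_continuous_onI continuous_intros)

text \<open>
  The characteristic function of the standard normal distribution, rescaled.
\<close>

lemma fourier_gaussian:
  fixes a y :: real
  assumes a: "a > 0"
  shows "has_bochner_integral lborel (\<lambda>x. cis (y * x) * of_real (exp (- (a * x\<^sup>2))))
           (of_real (sqrt (pi / a) * exp (- (y\<^sup>2 / (4 * a)))))"
proof -
  \<comment> \<open>The factor that turns \<open>a x\<^sup>2\<close> into half of a square, as in the standard normal density.\<close>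
  define c where "c = sqrt (2 * a)"
  have c: "c > 0" "c\<^sup>2 = 2 * a" using a by (simp_all add: c_def)
  define t where "t = y / c"
  have int: "integrable lborel (\<lambda>x. std_normal_density x *\<^sub>R cis (t * x))"
    by (rule Bochner_Integration.integrable_bound[OF integrable_normal_density[of 1 0]])
       (auto simp: normal_density_nonneg)
  have "(LINT x|lborel. std_normal_density x *\<^sub>R cis (t * x)) = char std_normal_distribution t"
    unfolding char_def by (subst integral_density) (auto simp: normal_density_nonneg cis_conv_exp)
  then have "has_bochner_integral lborel (\<lambda>x. std_normal_density x *\<^sub>R cis (t * x)) (exp (- (t\<^sup>2) / 2))"
    using int by (simp add: has_bochner_integral_iff char_std_normal_distribution exp_of_real)
  then have "has_bochner_integral lborel (\<lambda>x. std_normal_density (0 + c * x) *\<^sub>R cis (t * (0 + c * x)))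
      (complex_of_real (exp (- (t\<^sup>2) / 2)) /\<^sub>R \<bar>c\<bar>)"
    using c by (subst (asm) lborel_has_bochner_integral_real_affine_iff[where c=c and t=0]) (auto simp: exp_of_real)
  then have *: "has_bochner_integral lborel (\<lambda>x. sqrt (2 * pi) *\<^sub>R (std_normal_density (0 + c * x) *\<^sub>R cis (t * (0 + c * x))))
      (sqrt (2 * pi) *\<^sub>R (complex_of_real (exp (- (t\<^sup>2) / 2)) /\<^sub>R \<bar>c\<bar>))"
    by (rule has_bochner_integral_scaleR_right)
  have 1: "sqrt (2 * pi) *\<^sub>R (std_normal_density (0 + c * x) *\<^sub>R cis (t * (0 + c * x)))
      = cis (y * x) * of_real (exp (- (a * x\<^sup>2)))" for x
    using c by (simp add: std_normal_density_def t_def scaleR_conv_of_real power_mult_distrib mult_ac)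
  have "sqrt (2 * pi) * inverse c = sqrt (pi / a)"
    using a by (simp add: c_def real_sqrt_mult real_sqrt_divide field_simps)
  moreover have "t\<^sup>2 / 2 = y\<^sup>2 / (4 * a)"
    using c by (simp add: t_def power_divide)
  ultimately have 2: "sqrt (2 * pi) *\<^sub>R (complex_of_real (exp (- (t\<^sup>2) / 2)) /\<^sub>R \<bar>c\<bar>)
     = of_real (sqrt (pi / a) * exp (- (y\<^sup>2 / (4 * a))))"
    using c by (simp add: scaleR_conv_of_real) (simp flip: of_real_mult of_real_inverse mult.assoc)
  show ?thesis using * unfolding 1 2 .
qed

lemma gaussian_integral:
  fixes a :: real
  assumes a: "a > 0"
  shows "has_bochner_integral lborel (\<lambda>x. exp (- (a * x\<^sup>2))) (sqrt (pi / a))"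
  using has_bochner_integral_Re[OF fourier_gaussian[OF a, of 0]] by simp

lemma
  fixes a :: real
  assumes a: "a > 0"
  shows integrable_gaussian: "integrable lborel (\<lambda>x::'a::euclidean_space. exp (- (a * (norm x)\<^sup>2)))"
    and integral_gaussian: "(LINT x::'a|lborel. exp (- (a * (norm x)\<^sup>2))) = sqrt (pi / a) ^ DIM('a)"
proof -
  have eq: "exp (- (a * (norm x)\<^sup>2)) = (\<Prod>b\<in>Basis. exp (- (a * (x \<bullet> b)\<^sup>2)))" for x :: 'a
    unfolding power2_norm_eq_inner euclidean_inner[of x x]
    by (simp add: sum_distrib_left exp_sum sum_negf[symmetric] power2_eq_square)
  have i: "integrable lborel (\<lambda>x. exp (- (a * x\<^sup>2)))" "(LINT x|lborel. exp (- (a * x\<^sup>2))) = sqrt (pi / a)"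
    using gaussian_integral[OF a] by (auto simp: has_bochner_integral_iff)
  show "integrable lborel (\<lambda>x::'a. exp (- (a * (norm x)\<^sup>2)))"
    unfolding eq by (rule integrable_lborel_prod) (rule i)
  show "(LINT x::'a|lborel. exp (- (a * (norm x)\<^sup>2))) = sqrt (pi / a) ^ DIM('a)"
    unfolding eq by (subst integral_lborel_prod) (simp_all add: i)
qed

section \<open>The Fourier transform of the Cauchy density\<close>

lemma integrable_exp_neg_abs: "integrable lborel (\<lambda>x::real. exp (- \<bar>x\<bar>))"
proof -
  have "has_bochner_integral lborel (\<lambda>x. indicator {0..} x *\<^sub>R exp (- \<bar>x\<bar>)) (1::real)"
    using has_bochner_integral_I0i_power_exp_m'[of 0]
    by (rule has_bochner_integral_cong[THEN iffD1, rotated -1]) (auto split: split_indicator)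
  from has_bochner_integral_even_function[OF this] show ?thesis by (auto intro: integrable.intros)
qed

text \<open>
  The even part is a cosine transform on the half line, which has an elementary antiderivative;
  the odd part vanishes.
\<close>

lemma fourier_exp_neg_abs:
  fixes t :: real
  shows "has_bochner_integral lborel (\<lambda>\<mu>. of_real (exp (- \<bar>\<mu>\<bar>)) * cis (t * \<mu>)) (of_real (2 / (1 + t\<^sup>2)))"
proof -
  have int: "integrable lborel (\<lambda>\<mu>. indicator {0..} \<mu> *\<^sub>R (exp (- \<bar>\<mu>\<bar>) * g \<mu>))"
    if [measurable]: "g \<in> borel_measurable borel" and "\<And>\<mu>. \<bar>g \<mu>\<bar> \<le> 1" for g :: "real \<Rightarrow> real"
    by (rule Bochner_Integration.integrable_bound[OF integrable_exp_neg_abs])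
       (use that(2) in \<open>auto simp: abs_mult split: split_indicator\<close>)
  define F where "F \<mu> = exp (- \<mu>) * (t * sin (t * \<mu>) - cos (t * \<mu>)) / (1 + t\<^sup>2)" for \<mu>
  have pos: "1 + t\<^sup>2 > 0" by (simp add: add_pos_nonneg)
  have "(LBINT \<mu>=0..\<infinity>. exp (- \<mu>) * cos (t * \<mu>)) = 0 - (- 1 / (1 + t\<^sup>2))"
  proof (rule interval_integral_FTC_integrable[where F = F])
    show "(F has_vector_derivative exp (- \<mu>) * cos (t * \<mu>)) (at \<mu>)" for \<mu>
    proof -
      have "(F has_real_derivative (exp (- \<mu>) * cos (t * \<mu>) * (1 + t\<^sup>2)) / (1 + t\<^sup>2)) (at \<mu>)"
        unfolding F_def
        by (rule DERIV_cdivide) (auto intro!: derivative_eq_intros simp: algebra_simps power2_eq_square)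
      then show ?thesis
        using pos by (simp add: has_real_derivative_iff_has_vector_derivative)
    qed
    show "set_integrable lborel (einterval 0 \<infinity>) (\<lambda>\<mu>. exp (- \<mu>) * cos (t * \<mu>))"
      unfolding set_integrable_def
      by (rule Bochner_Integration.integrable_bound[OF integrable_exp_neg_abs])
         (auto simp: abs_mult einterval_iff split: split_indicator)
    show "((F \<circ> real_of_ereal) \<longlongrightarrow> - 1 / (1 + t\<^sup>2)) (at_right 0)"
      using pos unfolding zero_ereal_def ereal_tendsto_simps F_def
      by (auto intro!: tendsto_eq_intros)
    show "((F \<circ> real_of_ereal) \<longlongrightarrow> 0) (at_left \<infinity>)"
      unfolding ereal_tendsto_simps
    proof (rule Lim_null_comparison)
      show "\<forall>\<^sub>F \<mu> in at_top. norm (F \<mu>) \<le> exp (- \<mu>) * ((\<bar>t\<bar> + 1) / (1 + t\<^sup>2))"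
      proof (rule always_eventually, rule allI)
        fix \<mu>
        have "\<bar>t * sin (t * \<mu>) - cos (t * \<mu>)\<bar> \<le> \<bar>t * sin (t * \<mu>)\<bar> + \<bar>cos (t * \<mu>)\<bar>" by (rule abs_triangle_ineq4)
        also have "\<dots> \<le> \<bar>t\<bar> * 1 + 1" by (intro add_mono) (auto simp: abs_mult intro: mult_left_le)
        finally show "norm (F \<mu>) \<le> exp (- \<mu>) * ((\<bar>t\<bar> + 1) / (1 + t\<^sup>2))"
          using pos by (simp add: F_def abs_mult divide_right_mono)
      qed
      show "((\<lambda>\<mu>. exp (- \<mu>) * ((\<bar>t\<bar> + 1) / (1 + t\<^sup>2))) \<longlongrightarrow> 0) at_top"
        by (intro tendsto_mult_left_zero filterlim_compose[OF exp_at_bot] filterlim_uminus_at_bot_at_top)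
    qed
  qed (auto intro!: continuous_intros)
  then have "(LINT \<mu>|lborel. indicator {0<..} \<mu> *\<^sub>R (exp (- \<mu>) * cos (t * \<mu>))) = 1 / (1 + t\<^sup>2)"
    by (simp add: interval_lebesgue_integral_0_infty set_lebesgue_integral_def)
  also have "(LINT \<mu>|lborel. indicator {0<..} \<mu> *\<^sub>R (exp (- \<mu>) * cos (t * \<mu>))) =
             (LINT \<mu>|lborel. indicator {0..} \<mu> *\<^sub>R (exp (- \<bar>\<mu>\<bar>) * cos (t * \<mu>)))"
    using AE_lborel_singleton[of 0]
    by (intro integral_cong_AE) (auto split: split_indicator)
  finally have "has_bochner_integral lborel (\<lambda>\<mu>. indicator {0..} \<mu> *\<^sub>R (exp (- \<bar>\<mu>\<bar>) * cos (t * \<mu>))) (1 / (1 + t\<^sup>2))"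
    using int[of "\<lambda>\<mu>. cos (t * \<mu>)"] by (simp add: has_bochner_integral_iff)
  from has_bochner_integral_even_function[OF this]
  have c: "has_bochner_integral lborel (\<lambda>\<mu>. exp (- \<bar>\<mu>\<bar>) * cos (t * \<mu>)) (2 / (1 + t\<^sup>2))" by simp
  have "has_bochner_integral lborel (\<lambda>\<mu>. indicator {0..} \<mu> *\<^sub>R (exp (- \<bar>\<mu>\<bar>) * sin (t * \<mu>)))
      (LINT \<mu>|lborel. indicator {0..} \<mu> *\<^sub>R (exp (- \<bar>\<mu>\<bar>) * sin (t * \<mu>)))"
    using int[of "\<lambda>\<mu>. sin (t * \<mu>)"] by (simp add: has_bochner_integral_iff)
  from has_bochner_integral_odd_function[OF this]
  have s: "has_bochner_integral lborel (\<lambda>\<mu>. exp (- \<bar>\<mu>\<bar>) * sin (t * \<mu>)) 0" by simp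
  have "has_bochner_integral lborel (\<lambda>\<mu>. complex_of_real (exp (- \<bar>\<mu>\<bar>) * cos (t * \<mu>)) + \<i> * complex_of_real (exp (- \<bar>\<mu>\<bar>) * sin (t * \<mu>)))
     (of_real (2 / (1 + t\<^sup>2)) + \<i> * complex_of_real 0)"
    by (intro has_bochner_integral_add has_bochner_integral_mult_right has_bochner_integral_of_real c s)
  moreover have "complex_of_real (exp (- \<bar>\<mu>\<bar>) * cos (t * \<mu>)) + \<i> * complex_of_real (exp (- \<bar>\<mu>\<bar>) * sin (t * \<mu>))
     = of_real (exp (- \<bar>\<mu>\<bar>)) * cis (t * \<mu>)" for \<mu>
    by (simp add: complex_eq_iff)
  ultimately show ?thesis by simp
qed

lemma integrable_inverse_one_plus_sq: "integrable lborel (\<lambda>t::real. 1 / (1 + t\<^sup>2))"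
  using integrable_inverse_1_plus_square by (simp add: set_integrable_def inverse_eq_divide)

text \<open>
  Fourier inversion for \<open>e\<^bsup>-\<bar>\<mu>\<bar>\<^esup>\<close>. After insertion of the factor \<open>e\<^bsup>-a\<^sup>2t\<^sup>2\<^esup>\<close> the order of
  integration may be exchanged, and the inner integral becomes a Gaussian of width \<open>2a\<close> centred at
  \<open>\<omega>\<close>, against which \<open>e\<^bsup>-\<bar>\<mu>\<bar>\<^esup>\<close> is averaged. Both sides converge as \<open>a \<rightarrow> 0\<close>.
\<close>

lemma fourier_inverse_one_plus_sq:
  fixes \<omega> :: real
  shows "(LINT t|lborel. cis (\<omega> * t) * of_real (1 / (1 + t\<^sup>2))) = of_real (pi * exp (- \<bar>\<omega>\<bar>))"
proof -
  define a :: "nat \<Rightarrow> real" where "a n = inverse (real (Suc n))" for n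
  have a0: "a n > 0" for n by (simp add: a_def)
  have alim: "a \<longlonglongrightarrow> 0" unfolding a_def by (rule LIMSEQ_inverse_real_of_nat)
  define J where "J n = (LINT t|lborel. of_real (exp (- ((a n)\<^sup>2 * t\<^sup>2))) * (cis (\<omega> * t) * complex_of_real (1 / (1 + t\<^sup>2))))" for n
  have J_lim: "J \<longlonglongrightarrow> (LINT t|lborel. cis (\<omega> * t) * complex_of_real (1 / (1 + t\<^sup>2)))"
    unfolding J_def
  proof (rule integral_dominated_convergence[where w = "\<lambda>t. 1 / (1 + t\<^sup>2)"])
    show "AE t in lborel. (\<lambda>n. of_real (exp (- ((a n)\<^sup>2 * t\<^sup>2))) * (cis (\<omega> * t) * complex_of_real (1 / (1 + t\<^sup>2))))
       \<longlonglongrightarrow> cis (\<omega> * t) * complex_of_real (1 / (1 + t\<^sup>2))"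
    proof (rule AE_I2)
      fix t :: real
      have "(\<lambda>n. complex_of_real (exp (- ((a n)\<^sup>2 * t\<^sup>2)))) \<longlonglongrightarrow> of_real (exp (- (0\<^sup>2 * t\<^sup>2)))"
        by (intro tendsto_intros alim)
      from tendsto_mult_right[OF this, of "cis (\<omega> * t) * complex_of_real (1 / (1 + t\<^sup>2))"]
      show "(\<lambda>n. of_real (exp (- ((a n)\<^sup>2 * t\<^sup>2))) * (cis (\<omega> * t) * complex_of_real (1 / (1 + t\<^sup>2))))
         \<longlonglongrightarrow> cis (\<omega> * t) * complex_of_real (1 / (1 + t\<^sup>2))"
        by simp
    qed
    show "AE t in lborel. norm (of_real (exp (- ((a n)\<^sup>2 * t\<^sup>2))) * (cis (\<omega> * t) * complex_of_real (1 / (1 + t\<^sup>2)))) \<le> 1 / (1 + t\<^sup>2)" for n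
      by (rule AE_I2) (auto simp: norm_mult norm_divide add_pos_nonneg divide_right_mono simp del: of_real_add of_real_power)
  qed (use integrable_inverse_one_plus_sq in auto)
  have J_eq: "J n = of_real (sqrt pi * (LINT v|lborel. exp (- \<bar>\<omega> + 2 * a n * v\<bar>) * exp (- v\<^sup>2)))" for n
  proof -
    define f where "f t \<mu> = complex_of_real (exp (- ((a n)\<^sup>2 * t\<^sup>2))) * cis (\<omega> * t) * (of_real (exp (- \<bar>\<mu>\<bar>)) * cis (- t * \<mu>))" for t \<mu>
    have g: "integrable lborel (\<lambda>t. exp (- ((a n)\<^sup>2 * t\<^sup>2)))"
      using a0 by (intro integrable.intros[OF gaussian_integral] zero_less_power)
    have I: "integrable (lborel \<Otimes>\<^sub>M lborel) (\<lambda>(t, \<mu>). f t \<mu>)"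
    proof (rule lborel_pair.Fubini_integrable)
      show "(\<lambda>(t, \<mu>). f t \<mu>) \<in> borel_measurable (lborel \<Otimes>\<^sub>M lborel)" unfolding f_def by measurable
      show "integrable lborel (\<lambda>x. LINT y|lborel. norm (case (x, y) of (t, \<mu>) \<Rightarrow> f t \<mu>))"
        using g by (simp add: f_def norm_mult)
      show "AE x in lborel. integrable lborel (\<lambda>y. case (x, y) of (t, \<mu>) \<Rightarrow> f t \<mu>)"
        unfolding f_def prod.case
        by (intro AE_I2 integrable_mult_right integrable.intros[OF fourier_exp_neg_abs])
    qed
    have "2 * J n = (LINT t|lborel. (LINT \<mu>|lborel. f t \<mu>))"
      unfolding J_def f_def integral_mult_right_zero has_bochner_integral_integral_eq[OF fourier_exp_neg_abs]
      by (simp flip: integral_mult_right_zero) (simp add: mult_ac)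
    also have "\<dots> = (LINT \<mu>|lborel. (LINT t|lborel. f t \<mu>))"
      using lborel_pair.Fubini_integral[OF I] by simp
    also have "\<dots> = (LINT \<mu>|lborel. of_real (exp (- \<bar>\<mu>\<bar>) * (sqrt (pi / (a n)\<^sup>2) * exp (- ((\<omega> - \<mu>)\<^sup>2 / (4 * (a n)\<^sup>2))))))"
    proof (rule Bochner_Integration.integral_cong[OF refl])
      fix \<mu>
      have "f t \<mu> = of_real (exp (- \<bar>\<mu>\<bar>)) * (cis ((\<omega> - \<mu>) * t) * of_real (exp (- ((a n)\<^sup>2 * t\<^sup>2))))" for t
        by (simp add: f_def cis_mult algebra_simps)
      then show "(LINT t|lborel. f t \<mu>) = of_real (exp (- \<bar>\<mu>\<bar>) * (sqrt (pi / (a n)\<^sup>2) * exp (- ((\<omega> - \<mu>)\<^sup>2 / (4 * (a n)\<^sup>2)))))"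
        using has_bochner_integral_integral_eq[OF fourier_gaussian[of "(a n)\<^sup>2" "\<omega> - \<mu>"]] a0[of n] by simp
    qed
    also have "\<dots> = of_real (LINT \<mu>|lborel. exp (- \<bar>\<mu>\<bar>) * (sqrt (pi / (a n)\<^sup>2) * exp (- ((\<omega> - \<mu>)\<^sup>2 / (4 * (a n)\<^sup>2)))))"
      by (rule integral_complex_of_real)
    \<comment> \<open>Substitution \<open>\<mu> = \<omega> + 2 a v\<close>, which normalizes the width of the Gaussian.\<close>
    also have "(LINT \<mu>|lborel. exp (- \<bar>\<mu>\<bar>) * (sqrt (pi / (a n)\<^sup>2) * exp (- ((\<omega> - \<mu>)\<^sup>2 / (4 * (a n)\<^sup>2))))) =
        \<bar>2 * a n\<bar> *\<^sub>R (LINT v|lborel. exp (- \<bar>\<omega> + 2 * a n * v\<bar>) * (sqrt (pi / (a n)\<^sup>2) * exp (- ((\<omega> - (\<omega> + 2 * a n * v))\<^sup>2 / (4 * (a n)\<^sup>2)))))"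
      by (rule lborel_integral_real_affine) (use a0[of n] in simp)
    also have "\<dots> = (LINT v|lborel. 2 * sqrt pi * (exp (- \<bar>\<omega> + 2 * a n * v\<bar>) * exp (- v\<^sup>2)))"
      using a0[of n] unfolding real_scaleR_def integral_mult_right_zero[symmetric]
      by (intro Bochner_Integration.integral_cong refl) (simp add: real_sqrt_divide power_mult_distrib)
    also have "\<dots> = 2 * (sqrt pi * (LINT v|lborel. exp (- \<bar>\<omega> + 2 * a n * v\<bar>) * exp (- v\<^sup>2)))" by simp
    finally show ?thesis by simp
  qed
  have "(\<lambda>n. LINT v|lborel. exp (- \<bar>\<omega> + 2 * a n * v\<bar>) * exp (- v\<^sup>2)) \<longlonglongrightarrow> (LINT v|lborel. exp (- \<bar>\<omega>\<bar>) * exp (- v\<^sup>2))"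
  proof (rule integral_dominated_convergence[where w = "\<lambda>v. exp (- v\<^sup>2)"])
    show "integrable lborel (\<lambda>v::real. exp (- v\<^sup>2))"
      using gaussian_integral[of 1] by (simp add: has_bochner_integral_iff)
    show "AE v in lborel. (\<lambda>n. exp (- \<bar>\<omega> + 2 * a n * v\<bar>) * exp (- v\<^sup>2)) \<longlonglongrightarrow> exp (- \<bar>\<omega>\<bar>) * exp (- v\<^sup>2)"
      by (rule AE_I2) (auto intro!: tendsto_eq_intros alim)
  qed auto
  then have "(\<lambda>n. complex_of_real (sqrt pi * (LINT v|lborel. exp (- \<bar>\<omega> + 2 * a n * v\<bar>) * exp (- v\<^sup>2))))
     \<longlonglongrightarrow> of_real (sqrt pi * (exp (- \<bar>\<omega>\<bar>) * sqrt pi))"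
    using has_bochner_integral_integral_eq[OF gaussian_integral[of 1]]
    by (intro tendsto_intros) simp
  then have "(\<lambda>n. complex_of_real (sqrt pi * (LINT v|lborel. exp (- \<bar>\<omega> + 2 * a n * v\<bar>) * exp (- v\<^sup>2))))
     \<longlonglongrightarrow> of_real (sqrt pi * sqrt pi * exp (- \<bar>\<omega>\<bar>))"
    by (simp only: mult_ac)
  then have "J \<longlonglongrightarrow> of_real (pi * exp (- \<bar>\<omega>\<bar>))"
    unfolding J_eq[symmetric] by simp
  with J_lim show ?thesis by (rule LIMSEQ_unique)
qed

section \<open>The dispersing Gaussian packet\<close>

text \<open>
  The packet \<open>e\<^bsup>(1+it)\<Delta>\<^esup>\<delta>\<close>, a Gaussian of unit width at time \<open>0\<close>, has width comparable
  to \<open>spread t = \<bar>1 + i t\<bar>\<close> at time \<open>t\<close>; all decay rates are powers of this number.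
\<close>

definition spread :: "real \<Rightarrow> real" where "spread t = sqrt (1 + t\<^sup>2)"

lemma spread_ge_1: "spread t \<ge> 1" and spread_sq: "(spread t)\<^sup>2 = 1 + t\<^sup>2"
  by (simp_all add: spread_def)

lemma spread_measurable [measurable]: "spread \<in> borel_measurable borel"
  unfolding spread_def[abs_def] by measurable

lemma integrable_inverse_spread_sq: "integrable lborel (\<lambda>t. 1 / (spread t)\<^sup>2)"
  using integrable_inverse_one_plus_sq by (simp add: spread_sq)

text \<open>
  Up to normalization, the kernel of \<open>e\<^bsup>(1+it)\<Delta>\<^esup>\<close> on the line. It equals
  \<open>(\<pi>/z)\<^bsup>1/2\<^esup> e\<^bsup>-x\<^sup>2/(4z)\<^esup>\<close> with \<open>z = 1 + i t\<close>; its absolute value is found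
  below from real Gaussian integrals.
\<close>

definition schroedinger_kernel_1d :: "real \<Rightarrow> real \<Rightarrow> complex" where
  "schroedinger_kernel_1d t x = (LINT \<xi>|lborel. cis (x * \<xi> - t * \<xi>\<^sup>2) * of_real (exp (- \<xi>\<^sup>2)))"

lemma integrable_schroedinger_kernel_1d: "integrable lborel (\<lambda>\<xi>. cis (x * \<xi> - t * \<xi>\<^sup>2) * of_real (exp (- \<xi>\<^sup>2)))"
  by (rule Bochner_Integration.integrable_bound[OF integrable.intros[OF gaussian_integral[of 1]]])
     (auto simp: norm_mult)

text \<open>
  The square of the absolute value is a double integral over \<open>(\<eta>, \<eta> + p)\<close>. The quadratic phases
  of the two factors differ by a term that is linear in \<open>\<eta>\<close>, so that only real Gaussians with a
  linear phase remain when one integrates in \<open>\<eta>\<close> first and in \<open>p\<close> afterwards.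
\<close>

lemma norm_schroedinger_kernel_1d_sq: "(norm (schroedinger_kernel_1d t x))\<^sup>2 = pi / spread t * exp (- (x\<^sup>2 / (2 * (spread t)\<^sup>2)))"
proof -
  define e where "e \<xi> = cis (x * \<xi> - t * \<xi>\<^sup>2) * complex_of_real (exp (- \<xi>\<^sup>2))" for \<xi>
  have ie: "integrable lborel e" unfolding e_def[abs_def] by (rule integrable_schroedinger_kernel_1d)
  have [measurable]: "e \<in> borel_measurable borel" using ie by (auto dest: borel_measurable_integrable)
  define f where "f p \<eta> = e (\<eta> + p) * cnj (e \<eta>)" for p \<eta>
  have ne: "norm (e \<xi>) = exp (- \<xi>\<^sup>2)" for \<xi> by (simp add: e_def norm_mult)
  have tr: "(LINT p|lborel. e (\<eta> + p)) = schroedinger_kernel_1d t x" for \<eta>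
    using lborel_integral_real_affine[of 1 e \<eta>] by (simp add: schroedinger_kernel_1d_def e_def[abs_def])
  have itr: "integrable lborel (\<lambda>p. e (\<eta> + p))" for \<eta>
    using lborel_integrable_real_affine[OF ie, of 1 \<eta>] by simp
  have ntr: "(LINT p|lborel. exp (- (\<eta> + p)\<^sup>2)) = sqrt pi" for \<eta>
    using lborel_integral_real_affine[of 1 "\<lambda>p. exp (- p\<^sup>2)" \<eta>]
      has_bochner_integral_integral_eq[OF gaussian_integral[of 1]] by simp
  have I: "integrable (lborel \<Otimes>\<^sub>M lborel) (\<lambda>(\<eta>, p). f p \<eta>)"
  proof (rule lborel_pair.Fubini_integrable)
    show "(\<lambda>(\<eta>, p). f p \<eta>) \<in> borel_measurable (lborel \<Otimes>\<^sub>M lborel)" unfolding f_def by measurable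
    show "integrable lborel (\<lambda>x. LINT y|lborel. norm (case (x, y) of (\<eta>, p) \<Rightarrow> f p \<eta>))"
      using gaussian_integral[of 1] by (simp add: f_def norm_mult ne ntr has_bochner_integral_iff)
    show "AE x in lborel. integrable lborel (\<lambda>y. case (x, y) of (\<eta>, p) \<Rightarrow> f p \<eta>)"
      using itr by (simp add: f_def)
  qed
  have "schroedinger_kernel_1d t x * cnj (schroedinger_kernel_1d t x) = (LINT \<eta>|lborel. schroedinger_kernel_1d t x * cnj (e \<eta>))"
    by (simp only: schroedinger_kernel_1d_def e_def[symmetric] Bochner_Integration.integral_cnj[symmetric] integral_mult_right_zero)
  also have "\<dots> = (LINT \<eta>|lborel. (LINT p|lborel. f p \<eta>))"
    by (simp add: f_def tr)
  also have "\<dots> = (LINT p|lborel. (LINT \<eta>|lborel. f p \<eta>))"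
    using lborel_pair.Fubini_integral[OF I] by simp
  also have "(\<lambda>p. LINT \<eta>|lborel. f p \<eta>) =
      (\<lambda>p. sqrt (pi / 2) * (cis (x * p) * of_real (exp (- ((spread t)\<^sup>2 / 2 * p\<^sup>2)))))"
  proof
    fix p :: real
    \<comment> \<open>The shift \<open>\<eta> = q - p/2\<close> places the two arguments symmetrically and completes the square.\<close>
    have arg: "x * (q + p/2) - t * (q + p/2)\<^sup>2 - (x * (q - p/2) - t * (q - p/2)\<^sup>2) = x * p + (-2 * t * p) * q" for q
      by (simp add: algebra_simps power2_eq_square)
    have arg2: "- (q + p/2)\<^sup>2 + - (q - p/2)\<^sup>2 = - (p\<^sup>2 / 2) + - (2 * q\<^sup>2)" for q
      by (simp add: algebra_simps power2_eq_square)
    have fq: "f p (- (p/2) + 1 * q) = (cis (x * p) * of_real (exp (- (p\<^sup>2 / 2)))) * (cis ((-2 * t * p) * q) * of_real (exp (- (2 * q\<^sup>2))))" for q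
    proof -
      have "f p (- (p/2) + 1 * q) = e (q + p/2) * cnj (e (q - p/2))" by (simp add: f_def add_ac)
      also have "\<dots> = cis (x * (q + p/2) - t * (q + p/2)\<^sup>2 - (x * (q - p/2) - t * (q - p/2)\<^sup>2))
                     * of_real (exp (- (q + p/2)\<^sup>2 + - (q - p/2)\<^sup>2))"
        unfolding e_def by (simp only: complex_cnj_mult complex_cnj_complex_of_real cis_cnj
            exp_add of_real_mult diff_conv_add_uminus[of _ "x * (q - p/2) - t * (q - p/2)\<^sup>2"] cis_mult[symmetric]) (simp add: mult_ac)
      also have "\<dots> = (cis (x * p) * of_real (exp (- (p\<^sup>2 / 2)))) * (cis ((-2 * t * p) * q) * of_real (exp (- (2 * q\<^sup>2))))"
        unfolding arg arg2 by (simp only: exp_add of_real_mult cis_mult[symmetric] mult_ac)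
      finally show ?thesis .
    qed
    have "(LINT \<eta>|lborel. f p \<eta>) = (LINT q|lborel. f p (- (p/2) + 1 * q))"
      using lborel_integral_real_affine[of 1 "f p" "- (p/2)"] by simp
    also have "\<dots> = cis (x * p) * of_real (exp (- (p\<^sup>2 / 2))) * of_real (sqrt (pi / 2) * exp (- ((-2 * t * p)\<^sup>2 / (4 * 2))))"
      unfolding fq using has_bochner_integral_integral_eq[OF fourier_gaussian[of 2 "-2 * t * p"]] by simp
    also have "\<dots> = sqrt (pi / 2) * (cis (x * p) * of_real (exp (- (p\<^sup>2 / 2)) * exp (- ((-2 * t * p)\<^sup>2 / (4 * 2)))))"
      by (simp add: mult_ac)
    also have "exp (- (p\<^sup>2 / 2)) * exp (- ((-2 * t * p)\<^sup>2 / (4 * 2))) = exp (- ((spread t)\<^sup>2 / 2 * p\<^sup>2))"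
      by (simp add: spread_sq exp_add[symmetric] algebra_simps power_mult_distrib)
    finally show "(LINT \<eta>|lborel. f p \<eta>) = sqrt (pi / 2) * (cis (x * p) * of_real (exp (- ((spread t)\<^sup>2 / 2 * p\<^sup>2))))" .
  qed
  also have "(LINT p|lborel. sqrt (pi / 2) * (cis (x * p) * of_real (exp (- ((spread t)\<^sup>2 / 2 * p\<^sup>2))))) =
      sqrt (pi / 2) * of_real (sqrt (pi / ((spread t)\<^sup>2 / 2)) * exp (- (x\<^sup>2 / (4 * ((spread t)\<^sup>2 / 2)))))"
    using has_bochner_integral_integral_eq[OF fourier_gaussian[of "(spread t)\<^sup>2 / 2" x]] spread_ge_1[of t] by simp
  also have "\<dots> = of_real (sqrt (pi / 2) * sqrt (pi / ((spread t)\<^sup>2 / 2)) * exp (- (x\<^sup>2 / (2 * (spread t)\<^sup>2))))"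
    by (simp add: mult_ac)
  also have "sqrt (pi / 2) * sqrt (pi / ((spread t)\<^sup>2 / 2)) = pi / spread t"
    using spread_ge_1[of t] by (simp add: real_sqrt_mult real_sqrt_divide)
  finally have "complex_of_real ((norm (schroedinger_kernel_1d t x))\<^sup>2) = of_real (pi / spread t * exp (- (x\<^sup>2 / (2 * (spread t)\<^sup>2))))"
    by (simp only: complex_norm_square)
  then show ?thesis by (simp only: of_real_eq_iff)
qed

definition schroedinger_kernel :: "real \<Rightarrow> 'a::euclidean_space \<Rightarrow> complex" where
  "schroedinger_kernel t x = (LINT \<xi>|lborel. cis (x \<bullet> \<xi> - t * (norm \<xi>)\<^sup>2) * of_real (exp (- (norm \<xi>)\<^sup>2)))"

text \<open>
  The kernel is the product of the kernels of the coordinates.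
\<close>

lemma norm_schroedinger_kernel_sq:
  fixes x :: "'a::euclidean_space"
  shows "(norm (schroedinger_kernel t x))\<^sup>2 = (pi / spread t) ^ DIM('a) * exp (- ((norm x)\<^sup>2 / (2 * (spread t)\<^sup>2)))"
proof -
  have ce: "cis u * of_real (exp v) = exp (\<i> * of_real u + of_real v)" for u v
    by (simp add: cis_conv_exp exp_add exp_of_real)
  have eq: "cis (x \<bullet> \<xi> - t * (norm \<xi>)\<^sup>2) * of_real (exp (- (norm \<xi>)\<^sup>2)) =
     (\<Prod>b\<in>Basis. cis ((x \<bullet> b) * (\<xi> \<bullet> b) - t * (\<xi> \<bullet> b)\<^sup>2) * of_real (exp (- (\<xi> \<bullet> b)\<^sup>2)))" for \<xi> :: 'a
  proof -
    have n: "(norm \<xi>)\<^sup>2 = (\<Sum>b\<in>Basis. (\<xi> \<bullet> b)\<^sup>2)"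
      unfolding power2_norm_eq_inner euclidean_inner[of \<xi> \<xi>] by (simp add: power2_eq_square)
    show ?thesis
      unfolding ce n euclidean_inner[of x \<xi>] exp_sum[OF finite_Basis, symmetric]
      by (simp add: sum_distrib_left sum.distrib sum_subtractf sum_negf right_diff_distrib)
  qed
  have "schroedinger_kernel t x = (\<Prod>b\<in>Basis. schroedinger_kernel_1d t (x \<bullet> b))"
    unfolding schroedinger_kernel_def schroedinger_kernel_1d_def eq by (rule integral_lborel_prod) (rule integrable_schroedinger_kernel_1d)
  then have "(norm (schroedinger_kernel t x))\<^sup>2 = (\<Prod>b\<in>(Basis::'a set). pi / spread t * exp (- ((x \<bullet> b)\<^sup>2 / (2 * (spread t)\<^sup>2))))"
    by (simp add: prod_norm[symmetric] prod_power_distrib norm_schroedinger_kernel_1d_sq)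
  also have "\<dots> = (pi / spread t) ^ DIM('a) * exp (\<Sum>b\<in>(Basis::'a set). - ((x \<bullet> b)\<^sup>2 / (2 * (spread t)\<^sup>2)))"
    by (simp only: prod.distrib exp_sum[OF finite_Basis] prod_constant)
  also have "(\<Sum>b\<in>(Basis::'a set). - ((x \<bullet> b)\<^sup>2 / (2 * (spread t)\<^sup>2))) = - ((norm x)\<^sup>2 / (2 * (spread t)\<^sup>2))"
    unfolding power2_norm_eq_inner euclidean_inner[of x x] sum_negf sum_divide_distrib[symmetric]
    by (simp add: power2_eq_square)
  finally show ?thesis .
qed

text \<open>
  At time \<open>t\<close> the spatial integral of the Gaussian is a multiple of \<open>spread t ^ DIM('a)\<close>, which leaves
  the integrable function \<open>1 / (spread t)\<^sup>2\<close> of time.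
\<close>

lemma integrable_spreading_gaussian:
  "integrable lborel (\<lambda>z::real \<times> 'a::euclidean_space.
     1 / spread (fst z) ^ (DIM('a) + 2) * exp (- (1 / (4 * (spread (fst z))\<^sup>2) * (norm (snd z))\<^sup>2)))"
proof -
  define f :: "real \<times> 'a \<Rightarrow> real" where "f z =
    1 / spread (fst z) ^ (DIM('a) + 2) * exp (- (1 / (4 * (spread (fst z))\<^sup>2) * (norm (snd z))\<^sup>2))" for z
  have tp: "spread t > 0" for t using spread_ge_1[of t] by linarith
  have f0: "0 \<le> f z" for z using tp by (simp add: f_def less_imp_le)
  have int: "(LINT x|lborel. f (t, x)) = (2 * sqrt pi) ^ DIM('a) * (1 / (spread t)\<^sup>2)" for t
  proof -
    have "(LINT x|lborel. f (t, x)) = 1 / spread t ^ (DIM('a) + 2) * sqrt (pi / (1 / (4 * (spread t)\<^sup>2))) ^ DIM('a)"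
      unfolding f_def using tp[of t] by (simp only: fst_conv snd_conv integral_mult_right_zero) (subst integral_gaussian, simp_all)
    also have "sqrt (pi / (1 / (4 * (spread t)\<^sup>2))) = 2 * sqrt pi * spread t"
      using tp[of t] by (simp add: real_sqrt_mult)
    finally show ?thesis using tp[of t] by (simp add: power_mult_distrib power_add power2_eq_square)
  qed
  have "integrable (lborel \<Otimes>\<^sub>M lborel) f"
  proof (rule lborel_pair.Fubini_integrable)
    show "f \<in> borel_measurable (lborel \<Otimes>\<^sub>M lborel)" unfolding f_def by measurable
    show "integrable lborel (\<lambda>t. LINT x|lborel. norm (f (t, x)))"
      using integrable_mult_right[OF integrable_inverse_spread_sq, of "(2 * sqrt pi) ^ DIM('a)"] by (simp add: f0 int)
    show "AE t in lborel. integrable lborel (\<lambda>x. f (t, x))"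
      unfolding f_def fst_conv snd_conv using tp
      by (intro AE_I2 integrable_mult_right integrable_gaussian) simp
  qed
  then show ?thesis by (simp add: lborel_prod f_def[abs_def])
qed

section \<open>Waves emitted by a bounded set\<close>

text \<open>
  The inhomogeneity that is emitted from \<open>A\<close> around time \<open>s\<close>. The profile \<open>1/(1 + t\<^sup>2)\<close> in time is
  chosen because its Fourier transform is \<open>\<pi> e\<^bsup>-\<bar>\<omega>\<bar>\<^esup>\<close>, which is the Gaussian \<open>\<pi> e\<^bsup>-\<bar>\<xi>\<bar>\<^sup>2\<^esup>\<close> on the
  paraboloid.
\<close>

definition source :: "'a::euclidean_space set \<Rightarrow> real \<Rightarrow> real \<times> 'a \<Rightarrow> complex" where
  "source A s z = of_real (1 / (1 + (fst z - s)\<^sup>2)) * indicator A (snd z)"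

lemma borel_measurable_source:
  fixes A :: "'a::euclidean_space set"
  assumes [measurable]: "A \<in> sets borel"
  shows "source A s \<in> borel_measurable borel"
proof -
  have "(\<lambda>z::real \<times> 'a. complex_of_real (1 / (1 + (fst z - s)\<^sup>2))) \<in> borel_measurable (borel \<Otimes>\<^sub>M borel)"
    by measurable
  moreover have "(\<lambda>z::real \<times> 'a. indicator A (snd z) :: complex) \<in> borel_measurable (borel \<Otimes>\<^sub>M borel)"
    by measurable
  ultimately show ?thesis
    unfolding source_def[abs_def] borel_prod by (rule borel_measurable_times)
qed

lemma integrable_source:
  fixes A :: "'a::euclidean_space set"
  assumes [measurable]: "A \<in> sets borel" and fin: "emeasure lborel A < \<infinity>"
  shows "integrable lborel (source A s)"
proof -
  have "integrable lborel (\<lambda>t::real. 1 / (1 + (- s + 1 * t)\<^sup>2))"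
    by (rule lborel_integrable_real_affine[OF integrable_inverse_one_plus_sq]) simp
  then have "integrable lborel (\<lambda>t. complex_of_real (1 / (1 + (t - s)\<^sup>2)))"
    by (intro integrable_of_real) simp
  moreover have "integrable lborel (\<lambda>x. complex_of_real (indicator A x))"
    using fin by (intro integrable_of_real integrable_real_indicator) auto
  ultimately have "integrable lborel
      (\<lambda>z. complex_of_real (1 / (1 + (fst z - s)\<^sup>2)) * complex_of_real (indicator A (snd z)))"
    by (rule integrable_tensor)
  moreover have "complex_of_real (indicator A x) = indicator A x" for x
    by (simp split: split_indicator)
  ultimately show ?thesis by (simp add: source_def[abs_def])
qed

text \<open>
  The restriction to the paraboloid of the Fourier transform of \<open>source A 0\<close>; see
  \<open>restr_source\<close>.
\<close>

definition profile :: "'a::euclidean_space set \<Rightarrow> 'a \<Rightarrow> complex" where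
  "profile A \<xi> = of_real (pi * exp (- (norm \<xi>)\<^sup>2)) * (LINT y|lborel. indicator A y * cis (- (y \<bullet> \<xi>)))"

text \<open>
  A translation in time is a modulation on the paraboloid.
\<close>

lemma restr_source:
  fixes A :: "(real ^ 'n) set"
  shows "restr (source A s) \<xi> = cis (s * (norm \<xi>)\<^sup>2) * profile A \<xi>"
proof -
  let ?a = "LINT y|lborel. indicator A y * cis (- (y \<bullet> \<xi>))"
  have "cis (- (x \<bullet> \<xi> - t * (norm \<xi>)\<^sup>2)) * source A s (t, x) =
      (cis ((norm \<xi>)\<^sup>2 * t) * of_real (1 / (1 + (t - s)\<^sup>2))) * (indicator A x * cis (- (x \<bullet> \<xi>)))" for t x
    by (simp add: source_def cis_mult[symmetric] diff_conv_add_uminus mult_ac del: add_uminus_conv_diff of_real_divide)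
  then have "restr (source A s) \<xi> = (LINT t|lborel. cis ((norm \<xi>)\<^sup>2 * t) * of_real (1 / (1 + (t - s)\<^sup>2))) * ?a"
    unfolding restr_eq by (simp only: integral_mult_right_zero integral_mult_left_zero)
  also have "(LINT t|lborel. cis ((norm \<xi>)\<^sup>2 * t) * complex_of_real (1 / (1 + (t - s)\<^sup>2))) =
     (LINT t|lborel. cis (s * (norm \<xi>)\<^sup>2) * (cis ((norm \<xi>)\<^sup>2 * t) * of_real (1 / (1 + t\<^sup>2))))"
  proof -
    have "cis ((norm \<xi>)\<^sup>2 * (s + 1 * t)) = cis (s * (norm \<xi>)\<^sup>2) * cis ((norm \<xi>)\<^sup>2 * t)" for t
      by (simp add: cis_mult algebra_simps)
    then show ?thesis
      by (subst lborel_integral_real_affine[of 1 _ s]) (simp_all add: mult.assoc)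
  qed
  also have "\<dots> = cis (s * (norm \<xi>)\<^sup>2) * of_real (pi * exp (- (norm \<xi>)\<^sup>2))"
    by (simp only: integral_mult_right_zero fourier_inverse_one_plus_sq) simp
  finally show ?thesis by (simp add: profile_def mult_ac)
qed

lemma integrable_profile:
  fixes A :: "'a::euclidean_space set"
  assumes [measurable]: "A \<in> sets borel" and fin: "emeasure lborel A < \<infinity>"
  shows "integrable lborel (profile A)"
    and "integrable lborel (\<lambda>\<xi>. (norm (profile A \<xi>))\<^sup>2)"
proof -
  have iA: "integrable lborel (indicator A :: 'a \<Rightarrow> real)"
    using fin by (intro integrable_real_indicator) auto
  have bd: "norm (LINT y|lborel. indicator A y * cis (- (y \<bullet> \<xi>))) \<le> measure lborel A" for \<xi> :: 'a
  proof -
    have "norm (LINT y|lborel. indicator A y * cis (- (y \<bullet> \<xi>))) \<le> (LINT y|lborel. norm (indicator A y * cis (- (y \<bullet> \<xi>))))"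
      by (rule integral_norm_bound)
    also have "\<dots> \<le> (LINT y|lborel. indicator A y)"
      by (rule integral_mono'[OF iA]) (auto simp: norm_mult split: split_indicator)
    finally show ?thesis by simp
  qed
  have b: "norm (profile A \<xi>) \<le> pi * measure lborel A * exp (- (1 * (norm \<xi>)\<^sup>2))" for \<xi>
    using mult_left_mono[OF bd[of \<xi>], of "pi * exp (- (norm \<xi>)\<^sup>2)"]
    by (simp add: profile_def norm_mult mult_ac)
  have [measurable]: "profile A \<in> borel_measurable borel"
    unfolding profile_def[abs_def] by measurable
  have g: "integrable lborel (\<lambda>\<xi>::'a. pi * measure lborel A * exp (- (1 * (norm \<xi>)\<^sup>2)))"
    by (intro integrable_mult_right integrable_gaussian) simp
  show "integrable lborel (profile A)"
    by (rule Bochner_Integration.integrable_bound[OF g]) (use b in auto)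
  show "integrable lborel (\<lambda>\<xi>. (norm (profile A \<xi>))\<^sup>2)"
  proof (rule Bochner_Integration.integrable_bound[OF integrable_mult_right[OF g, of "pi * measure lborel A"]])
    show "AE \<xi> in lborel. norm ((norm (profile A \<xi>))\<^sup>2) \<le> norm (pi * measure lborel A * (pi * measure lborel A * exp (- (1 * (norm \<xi>)\<^sup>2))))"
    proof (rule AE_I2)
      fix \<xi> :: 'a
      have "norm (profile A \<xi>) \<le> pi * measure lborel A * 1"
        using b[of \<xi>] by (rule order_trans) (intro mult_left_mono, auto)
      then have "norm (profile A \<xi>) * norm (profile A \<xi>) \<le> pi * measure lborel A * (pi * measure lborel A * exp (- (1 * (norm \<xi>)\<^sup>2)))"
        using b[of \<xi>] by (intro mult_mono) auto
      then show "norm ((norm (profile A \<xi>))\<^sup>2) \<le> norm (pi * measure lborel A * (pi * measure lborel A * exp (- (1 * (norm \<xi>)\<^sup>2))))"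
        by (simp add: power2_eq_square)
    qed
  qed measurable
qed

text \<open>
  Near the origin the Fourier transform of \<open>1\<^sub>A\<close> is close to the measure of \<open>A\<close>.
\<close>

lemma profile_nonzero:
  fixes A :: "'a::euclidean_space set"
  assumes A[measurable]: "A \<in> sets borel" and R: "A \<subseteq> cball 0 R" and pos: "emeasure lborel A \<noteq> 0"
  shows "(LINT \<xi>|lborel. (norm (profile A \<xi>))\<^sup>2) > 0"
proof (rule ccontr)
  have fin: "emeasure lborel A < \<infinity>"
    using R by (intro emeasure_bounded_finite bounded_subset[OF bounded_cball])
  have iA: "integrable lborel (indicator A :: 'a \<Rightarrow> real)"
    using fin by (intro integrable_real_indicator) auto
  have mA: "measure lborel A > 0"
    using pos fin by (simp add: measure_def enn2real_positive_iff zero_less_iff_neq_zero)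
  \<comment> \<open>For \<open>\<bar>\<xi>\<bar> < r\<close> and \<open>y \<in> A\<close> the phase \<open>y \<bullet> \<xi>\<close> is at most \<open>1/2\<close>, so its cosine is at least \<open>1/2\<close>.\<close>
  define r where "r = 1 / (2 * (\<bar>R\<bar> + 1))"
  have r: "r > 0" by (simp add: r_def)
  have nz: "profile A \<xi> \<noteq> 0" if \<xi>: "\<xi> \<in> ball 0 r" for \<xi>
  proof
    assume "profile A \<xi> = 0"
    then have z: "(LINT y|lborel. indicator A y * cis (- (y \<bullet> \<xi>))) = 0" by (simp add: profile_def)
    have ic: "integrable lborel (\<lambda>y. indicator A y * cis (- (y \<bullet> \<xi>)))"
      by (rule Bochner_Integration.integrable_bound[OF iA]) (auto simp: norm_mult split: split_indicator)
    have "measure lborel A / 2 = (LINT y|lborel. indicator A y * (1/2))" by simp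
    also have "\<dots> \<le> (LINT y|lborel. Re (indicator A y * cis (- (y \<bullet> \<xi>))))"
    proof (rule integral_mono)
      fix y :: 'a
      have "cos (y \<bullet> \<xi>) \<ge> 1/2" if y: "y \<in> A"
      proof -
        have "\<bar>y \<bullet> \<xi>\<bar> \<le> norm y * norm \<xi>" by (rule Cauchy_Schwarz_ineq2)
        also have "\<dots> \<le> (\<bar>R\<bar> + 1) * r" using y R \<xi> by (intro mult_mono) auto
        also have "\<dots> = 1/2" by (simp add: r_def)
        finally have "\<bar>y \<bullet> \<xi>\<bar> \<le> 1/2" .
        have "norm (iexp (y \<bullet> \<xi>) - (\<Sum>k\<le>0. (\<i> * (y \<bullet> \<xi>)) ^ k / fact k)) \<le> \<bar>y \<bullet> \<xi>\<bar> ^ Suc 0 / fact (Suc 0)"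
          by (rule iexp_approx1)
        then have "norm (cis (y \<bullet> \<xi>) - 1) \<le> 1/2" using \<open>\<bar>y \<bullet> \<xi>\<bar> \<le> 1/2\<close> by (simp add: cis_conv_exp)
        then have "\<bar>Re (cis (y \<bullet> \<xi>) - 1)\<bar> \<le> 1/2" using abs_Re_le_cmod order_trans by blast
        then show ?thesis by (simp add: abs_if split: if_splits)
      qed
      then show "indicator A y * (1/2) \<le> Re (indicator A y * cis (- (y \<bullet> \<xi>)))"
        by (auto split: split_indicator)
    next
      show "integrable lborel (\<lambda>y. Re (indicator A y * cis (- (y \<bullet> \<xi>))))" using ic by (rule integrable_Re)
      show "integrable lborel (\<lambda>y. indicator A y * (1/2::real))" using iA by (rule integrable_mult_left)
    qed
    also have "\<dots> = Re (LINT y|lborel. indicator A y * cis (- (y \<bullet> \<xi>)))" by (rule integral_Re[OF ic])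
    finally show False using z mA by simp
  qed
  assume "\<not> ?thesis"
  then have "(LINT \<xi>|lborel. (norm (profile A \<xi>))\<^sup>2) = 0"
    by (simp add: not_less antisym)
  then have "AE \<xi> in lborel. (norm (profile A \<xi>))\<^sup>2 = 0"
    using integral_nonneg_eq_0_iff_AE[OF integrable_profile(2)[OF A fin]] by simp
  then have "AE \<xi> in lborel. \<xi> \<notin> ball (0::'a) r"
    by eventually_elim (use nz in auto)
  then have "emeasure lborel (ball (0::'a) r) = 0"
    by (subst (asm) AE_iff_measurable[of "ball (0::'a) r"]) (auto simp: ball_def)
  moreover have "emeasure lborel (ball (0::'a) r) > 0"
    using r by (metis content_ball_pos emeasure_lborel_ball_finite less_numeral_extra(3) measure_def enn2real_0 zero_less_iff_neq_zero)
  ultimately show False by simp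
qed

text \<open>
  Up to a constant factor, the solution \<open>e\<^bsup>(1+it)\<Delta>\<^esup> 1\<^sub>A\<close> of the Schroedinger equation.
\<close>

definition wave :: "'a::euclidean_space set \<Rightarrow> real \<times> 'a \<Rightarrow> complex" where
  "wave A z = of_real pi * (LINT y|lborel. indicator A y * schroedinger_kernel (fst z) (snd z - y))"

lemma restr_adj_restr_source:
  fixes A :: "(real ^ 'n) set"
  assumes [measurable]: "A \<in> sets borel" and fin: "emeasure lborel A < \<infinity>"
  shows "restr_adj (restr (source A s)) (t, x) = wave A (t - s, x)"
proof -
  define f :: "real^'n \<Rightarrow> real^'n \<Rightarrow> complex" where
    "f \<xi> y = cis (x \<bullet> \<xi> - t * (norm \<xi>)\<^sup>2) * cis (s * (norm \<xi>)\<^sup>2) * of_real (exp (- (norm \<xi>)\<^sup>2)) * (indicator A y * cis (- (y \<bullet> \<xi>)))" for \<xi> y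
  have ig: "integrable lborel (\<lambda>\<xi>::real^'n. complex_of_real (exp (- (norm \<xi>)\<^sup>2)))"
    using integrable_gaussian[of 1, where 'a = "real^'n"] by simp
  have iA: "integrable lborel (indicator A :: real^'n \<Rightarrow> complex)"
  proof -
    have "complex_of_real (indicator A x) = indicator A x" for x by (simp split: split_indicator)
    moreover have "integrable lborel (\<lambda>x. complex_of_real (indicator A x))"
      using fin by (intro integrable_of_real integrable_real_indicator) auto
    ultimately show ?thesis by simp
  qed
  have I: "integrable (lborel \<Otimes>\<^sub>M lborel) (\<lambda>(\<xi>, y). f \<xi> y)"
  proof (rule Bochner_Integration.integrable_bound)
    show "integrable (lborel \<Otimes>\<^sub>M lborel) (\<lambda>z::(real^'n) \<times> (real^'n). complex_of_real (exp (- (norm (fst z))\<^sup>2)) * indicator A (snd z))"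
      using integrable_tensor[OF ig iA] by (simp add: lborel_prod)
    show "(\<lambda>(\<xi>, y). f \<xi> y) \<in> borel_measurable (lborel \<Otimes>\<^sub>M lborel)"
      unfolding f_def by measurable
  qed (auto simp: f_def norm_mult)
  have "restr_adj (restr (source A s)) (t, x) = of_real pi * (LINT \<xi>|lborel. (LINT y|lborel. f \<xi> y))"
    unfolding restr_adj_def restr_source profile_def f_def
    by (simp flip: integral_mult_right_zero) (simp add: mult_ac)
  also have "(LINT \<xi>|lborel. (LINT y|lborel. f \<xi> y)) = (LINT y|lborel. (LINT \<xi>|lborel. f \<xi> y))"
    using lborel_pair.Fubini_integral[OF I] by simp
  also have "\<dots> = (LINT y|lborel. indicator A y * schroedinger_kernel (t - s) (x - y))"
  proof (rule Bochner_Integration.integral_cong[OF refl])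
    fix y
    have arg: "(x - y) \<bullet> \<xi> - (t - s) * (norm \<xi>)\<^sup>2 = x \<bullet> \<xi> - t * (norm \<xi>)\<^sup>2 + s * (norm \<xi>)\<^sup>2 + - (y \<bullet> \<xi>)" for \<xi>
      by (simp add: algebra_simps inner_diff_left)
    have "f \<xi> y = indicator A y * (cis ((x - y) \<bullet> \<xi> - (t - s) * (norm \<xi>)\<^sup>2) * of_real (exp (- (norm \<xi>)\<^sup>2)))" for \<xi>
      unfolding f_def arg cis_mult[symmetric] by (simp only: mult_ac)
    then show "(LINT \<xi>|lborel. f \<xi> y) = indicator A y * schroedinger_kernel (t - s) (x - y)"
      by (simp add: schroedinger_kernel_def)
  qed
  finally show ?thesis by (simp add: wave_def)
qed

lemma wave_eq_restr_adj:
  fixes A :: "(real ^ 'n) set"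
  assumes "A \<in> sets borel" "emeasure lborel A < \<infinity>"
  shows "wave A = restr_adj (profile A)"
proof
  fix z
  have "restr (source A 0) = profile A" by (rule ext) (simp add: restr_source)
  then show "wave A z = restr_adj (profile A) z"
    using restr_adj_restr_source[OF assms, of 0 "fst z" "snd z"] by simp
qed

text \<open>
  Each point of \<open>A\<close> emits a packet whose size is given by \<open>norm_schroedinger_kernel_sq\<close>. Since \<open>A\<close> is
  bounded, \<open>\<bar>x\<bar>\<^sup>2 \<le> 2 \<bar>x - y\<bar>\<^sup>2 + 2 R\<^sup>2\<close> for \<open>y \<in> A\<close>, so all these packets are dominated by one
  Gaussian centred at the origin.
\<close>

lemma norm_wave_le:
  fixes A :: "'a::euclidean_space set"
  assumes A: "A \<in> sets borel" "A \<subseteq> cball 0 R"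
  shows "(norm (wave A (t, x)))\<^sup>2 \<le> (pi * measure lborel A)\<^sup>2 * pi ^ DIM('a) * exp (R\<^sup>2 / 2) *
     (1 / spread t ^ DIM('a) * exp (- (1 / (4 * (spread t)\<^sup>2) * (norm x)\<^sup>2)))"
proof -
  define B where "B = (pi / spread t) ^ DIM('a) * (exp (R\<^sup>2 / 2) * exp (- (1 / (4 * (spread t)\<^sup>2) * (norm x)\<^sup>2)))"
  have tp: "spread t > 0" using spread_ge_1[of t] by linarith
  have B0: "B \<ge> 0" using tp by (simp add: B_def)
  have fin: "emeasure lborel A < \<infinity>"
    using A by (intro emeasure_bounded_finite bounded_subset[OF bounded_cball])
  have iA: "integrable lborel (\<lambda>y. indicator A y * sqrt B)"
    using fin A by (intro integrable_mult_left) (simp add: integrable_indicator_iff)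
  have bd: "norm (schroedinger_kernel t (x - y)) \<le> sqrt B" if y: "y \<in> A" for y
  proof (rule real_le_rsqrt)
    have "norm y \<le> R" using y A by auto
    have "norm x \<le> norm (x - y) + norm y" using norm_triangle_ineq[of "x - y" y] by simp
    then have "(norm x)\<^sup>2 \<le> (norm (x - y) + norm y)\<^sup>2" by (intro power_mono) auto
    also have "\<dots> \<le> 2 * (norm (x - y))\<^sup>2 + 2 * (norm y)\<^sup>2"
      using sum_squares_bound[of "norm (x - y)" "norm y"] by (simp add: power2_sum)
    also have "(norm y)\<^sup>2 \<le> R\<^sup>2" using \<open>norm y \<le> R\<close> by (intro power_mono) auto
    finally have 1: "(norm x)\<^sup>2 \<le> 2 * (norm (x - y))\<^sup>2 + 2 * R\<^sup>2" by simp
    have "(norm x)\<^sup>2 / (4 * (spread t)\<^sup>2) \<le> (2 * (norm (x - y))\<^sup>2 + 2 * R\<^sup>2) / (4 * (spread t)\<^sup>2)"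
      by (rule divide_right_mono[OF 1]) simp
    also have "\<dots> = (norm (x - y))\<^sup>2 / (2 * (spread t)\<^sup>2) + R\<^sup>2 / 2 / (spread t)\<^sup>2"
      using tp by (simp add: field_simps)
    also have "R\<^sup>2 / 2 / (spread t)\<^sup>2 \<le> R\<^sup>2 / 2 / 1"
      using spread_ge_1[of t] by (intro divide_left_mono) (auto intro: one_le_power)
    finally have "- ((norm (x - y))\<^sup>2 / (2 * (spread t)\<^sup>2)) \<le> R\<^sup>2 / 2 + - (1 / (4 * (spread t)\<^sup>2) * (norm x)\<^sup>2)"
      by simp
    then have "exp (- ((norm (x - y))\<^sup>2 / (2 * (spread t)\<^sup>2))) \<le> exp (R\<^sup>2 / 2) * exp (- (1 / (4 * (spread t)\<^sup>2) * (norm x)\<^sup>2))"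
      unfolding exp_add[symmetric] by (simp only: exp_le_cancel_iff)
    then show "(norm (schroedinger_kernel t (x - y)))\<^sup>2 \<le> B"
      unfolding norm_schroedinger_kernel_sq B_def using tp by (intro mult_left_mono) auto
  qed
  have "norm (LINT y|lborel. indicator A y * schroedinger_kernel t (x - y)) \<le> (LINT y|lborel. norm (indicator A y * schroedinger_kernel t (x - y)))"
    by (rule integral_norm_bound)
  also have "\<dots> \<le> (LINT y|lborel. indicator A y * sqrt B)"
    by (rule integral_mono'[OF iA]) (use bd B0 in \<open>auto split: split_indicator\<close>)
  also have "\<dots> = measure lborel A * sqrt B" using A by simp
  finally have "norm (wave A (t, x)) \<le> pi * (measure lborel A * sqrt B)"
    by (simp add: wave_def norm_mult)
  then have "(norm (wave A (t, x)))\<^sup>2 \<le> (pi * (measure lborel A * sqrt B))\<^sup>2"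
    by (intro power_mono) auto
  also have "\<dots> = (pi * measure lborel A)\<^sup>2 * B" using B0 by (simp add: power_mult_distrib)
  finally show ?thesis by (simp add: B_def power_divide mult_ac)
qed

text \<open>
  Dispersion: at a fixed point of space the wave dies out in the distant past.
\<close>

lemma wave_tendsto_zero:
  fixes x :: "'a::euclidean_space"
  assumes A: "A \<in> sets borel" "A \<subseteq> cball 0 R"
  shows "(\<lambda>n. wave A (t - real n, x)) \<longlonglongrightarrow> 0"
proof -
  define C where "C = (pi * measure lborel A)\<^sup>2 * pi ^ DIM('a) * exp (R\<^sup>2 / 2)"
  have C0: "C \<ge> 0" by (simp add: C_def)
  have le: "(norm (wave A (t - real n, x)))\<^sup>2 \<le> C * (1 / spread (t - real n))" for n
  proof -
    have "1 / spread (t - real n) ^ DIM('a) * exp (- (1 / (4 * (spread (t - real n))\<^sup>2) * (norm x)\<^sup>2)) \<le> 1 / spread (t - real n) * 1"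
      using spread_ge_1[of "t - real n"] by (intro mult_mono divide_left_mono self_le_power) auto
    from mult_left_mono[OF this C0] show ?thesis
      using norm_wave_le[OF A, of "t - real n" x] unfolding C_def[symmetric] by simp
  qed
  have "(\<lambda>n. 1 / spread (t - real n)) \<longlonglongrightarrow> 0" unfolding spread_def by real_asymp
  then have "(\<lambda>n. C * (1 / spread (t - real n))) \<longlonglongrightarrow> 0" by (rule tendsto_mult_right_zero)
  then have "(\<lambda>n. (norm (wave A (t - real n, x)))\<^sup>2) \<longlonglongrightarrow> 0"
    by (rule Lim_null_comparison[rotated]) (use le in auto)
  then have "(\<lambda>n. sqrt ((norm (wave A (t - real n, x)))\<^sup>2)) \<longlonglongrightarrow> sqrt 0" by (rule tendsto_real_sqrt)
  then show ?thesis by (simp add: tendsto_norm_zero_iff)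
qed

section \<open>Translation and limits in the space of square integrable functions\<close>

lemma LINT_lborel_translate:
  fixes f :: "'a::euclidean_space \<Rightarrow> 'b::{banach,second_countable_topology}"
  assumes [measurable]: "f \<in> borel_measurable borel"
  shows "(LINT z|lborel. f (c + z)) = (LINT z|lborel. f z)"
proof -
  have "(LINT z|lborel. f z) = (LINT z|distr lborel borel ((+) c). f z)"
    by (simp only: lborel_distr_plus)
  also have "\<dots> = (LINT z|lborel. f (c + z))" by (subst integral_distr) auto
  finally show ?thesis by simp
qed

lemma
  fixes f :: "'a::euclidean_space \<Rightarrow> complex"
  assumes f: "f \<in> L2"
  shows L2_translate: "(\<lambda>z. f (c + z)) \<in> L2"
    and L2_norm_translate: "L2_norm (\<lambda>z. f (c + z)) = L2_norm f"
proof -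
  have [measurable]: "f \<in> borel_measurable borel" using f by (simp add: L2_def)
  have "integrable (distr lborel borel ((+) c)) (\<lambda>z. (norm (f z))\<^sup>2)"
    using f by (simp add: lborel_distr_plus L2_def)
  then show "(\<lambda>z. f (c + z)) \<in> L2"
    by (subst (asm) integrable_distr_eq) (auto simp: L2_def)
  show "L2_norm (\<lambda>z. f (c + z)) = L2_norm f"
    unfolding L2_norm_def by (subst LINT_lborel_translate[of "\<lambda>z. (norm (f z))\<^sup>2"]) auto
qed

text \<open>
  By Fatou's lemma the \<open>L\<^sup>2\<close> limit vanishes almost everywhere.
\<close>

lemma L2_tendsto_pointwise_zero:
  fixes Hs :: "nat \<Rightarrow> 'a::euclidean_space \<Rightarrow> complex"
  assumes Hs: "\<And>n. Hs n \<in> L2" and H: "H \<in> L2" and lim: "L2_tendsto Hs H"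
    and pw: "\<And>z. (\<lambda>n. Hs n z) \<longlonglongrightarrow> 0"
  shows "(\<lambda>n. L2_norm (Hs n)) \<longlonglongrightarrow> 0"
proof -
  have [measurable]: "Hs n \<in> borel_measurable borel" "H \<in> borel_measurable borel" for n
    using Hs[of n] H by (auto simp: L2_def)
  have nn: "(\<integral>\<^sup>+z. ennreal ((norm (Hs n z - H z))\<^sup>2) \<partial>lborel) = ennreal ((L2_norm (\<lambda>z. Hs n z - H z))\<^sup>2)" for n
    using L2_diff[OF Hs[of n] H] by (subst nn_integral_eq_integral) (auto simp: L2_def L2_norm_def)
  have "(\<integral>\<^sup>+z. ennreal ((norm (H z))\<^sup>2) \<partial>lborel) = (\<integral>\<^sup>+z. liminf (\<lambda>n. ennreal ((norm (Hs n z - H z))\<^sup>2)) \<partial>lborel)"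
  proof (rule nn_integral_cong)
    fix z
    have "(\<lambda>n. ennreal ((norm (Hs n z - H z))\<^sup>2)) \<longlonglongrightarrow> ennreal ((norm (0 - H z))\<^sup>2)"
      by (intro tendsto_intros tendsto_ennrealI pw)
    from lim_imp_Liminf[OF _ this] show "ennreal ((norm (H z))\<^sup>2) = liminf (\<lambda>n. ennreal ((norm (Hs n z - H z))\<^sup>2))"
      by simp
  qed
  also have "\<dots> \<le> liminf (\<lambda>n. \<integral>\<^sup>+z. ennreal ((norm (Hs n z - H z))\<^sup>2) \<partial>lborel)"
    by (rule nn_integral_liminf) auto
  also have "\<dots> = 0"
  proof -
    have "(\<lambda>n. ennreal ((L2_norm (\<lambda>z. Hs n z - H z))\<^sup>2)) \<longlonglongrightarrow> ennreal (0\<^sup>2)"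
      using lim unfolding L2_tendsto_def by (intro tendsto_ennrealI tendsto_intros)
    from lim_imp_Liminf[OF _ this] show ?thesis unfolding nn by simp
  qed
  finally have "AE z in lborel. H z = 0"
    by (subst (asm) le_zero_eq, subst (asm) nn_integral_0_iff_AE) auto
  then have "L2_norm (Hs n) = L2_norm (\<lambda>z. Hs n z - H z)" for n
    unfolding L2_norm_def by (intro arg_cong[where f = sqrt] integral_cong_AE) auto
  then show ?thesis using lim by (simp add: L2_tendsto_def)
qed

section \<open>The input and output functions\<close>

lemma essentially_nonzero_on_bounded_set:
  fixes W :: "'a::euclidean_space \<Rightarrow> complex"
  assumes W[measurable]: "W \<in> borel_measurable lborel" and nz: "\<not> (AE x in lborel. W x = 0)"
  obtains A m where "A \<in> sets borel" "A \<subseteq> cball 0 m" "emeasure lborel A \<noteq> 0"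
    "m > 0" "\<And>x. x \<in> A \<Longrightarrow> norm (W x) \<ge> 1 / m"
proof -
  define A where "A n = {x. norm (W x) \<ge> 1 / real (Suc n) \<and> norm x \<le> real (Suc n)}" for n
  have [measurable]: "A n \<in> sets borel" for n unfolding A_def by measurable
  have "\<exists>n. emeasure lborel (A n) \<noteq> 0"
  proof (rule ccontr)
    assume "\<not> ?thesis"
    then have "AE x in lborel. \<forall>n. x \<notin> A n"
      by (subst AE_all_countable) (auto intro!: AE_I'[of "A n" for n] simp: null_sets_def)
    then have "AE x in lborel. W x = 0"
    proof eventually_elim
      case (elim x)
      show "W x = 0"
      proof (rule ccontr)
        assume "W x \<noteq> 0"
        then obtain n where n: "inverse (real (Suc n)) < norm (W x)"
          using reals_Archimedean[of "norm (W x)"] by auto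
        obtain k where k: "norm x \<le> real k" using real_arch_simple by blast
        have "1 / real (Suc (max n k)) \<le> 1 / real (Suc n)" by (intro divide_left_mono) auto
        then have "x \<in> A (max n k)" using n k by (auto simp: A_def inverse_eq_divide)
        then show False using elim by blast
      qed
    qed
    then show False using nz by simp
  qed
  then obtain n where "emeasure lborel (A n) \<noteq> 0" ..
  then show thesis by (intro that[of "A n" "real (Suc n)"]) (auto simp: A_def)
qed

text \<open>
  Division by \<open>W\<close> is harmless where \<open>\<bar>W\<bar>\<close> is bounded below. Outside \<open>A\<close> the quotient
  is \<open>0\<close>, even where \<open>W\<close> vanishes.
\<close>

lemma source_quotient_in_L2:
  fixes W :: "'a::euclidean_space \<Rightarrow> complex"
  assumes W: "W \<in> borel_measurable lborel"
    and A: "A \<in> sets borel" "emeasure lborel A < \<infinity>"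
    and m: "m > 0" "\<And>x. x \<in> A \<Longrightarrow> norm (W x) \<ge> 1 / m"
  shows "(\<lambda>z. source A s z / W (snd z)) \<in> L2"
proof -
  define F where "F z = source A s z / W (snd z)" for z
  note [measurable] = borel_measurable_source[OF A(1)]
  have [measurable]: "(\<lambda>z::real \<times> 'a. W (snd z)) \<in> borel_measurable borel"
    using W unfolding borel_prod[symmetric] by measurable
  have [measurable]: "F \<in> borel_measurable borel" unfolding F_def[abs_def] by measurable
  have "integrable lborel (\<lambda>z. (norm (F z))\<^sup>2)"
  proof (rule Bochner_Integration.integrable_bound[OF integrable_mult_right[OF integrable_norm[OF integrable_source[OF A]], of "m\<^sup>2"]])
    show "AE z in lborel. norm ((norm (F z))\<^sup>2) \<le> norm (m\<^sup>2 * norm (source A s z))"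
    proof (rule AE_I2)
      fix z :: "real \<times> 'a"
      have s1: "norm (source A s z) \<le> 1"
        by (auto simp: source_def norm_mult norm_divide divide_le_eq add_pos_nonneg split: split_indicator simp del: of_real_add of_real_power)
      have "norm (F z) \<le> m * norm (source A s z)"
      proof (cases "snd z \<in> A")
        case True
        then have "inverse (norm (W (snd z))) \<le> inverse (1 / m)"
          using m(1) m(2)[OF True] by (intro le_imp_inverse_le) auto
        then have "inverse (norm (W (snd z))) * norm (source A s z) \<le> m * norm (source A s z)"
          by (intro mult_right_mono) auto
        then show ?thesis by (simp add: F_def divide_inverse norm_mult norm_inverse mult.commute)
      qed (simp add: F_def source_def)
      then have "(norm (F z))\<^sup>2 \<le> (m * norm (source A s z))\<^sup>2" by (intro power_mono) auto
      also have "\<dots> = m\<^sup>2 * (norm (source A s z) * norm (source A s z))" by (simp add: power2_eq_square)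
      also have "\<dots> \<le> m\<^sup>2 * (norm (source A s z) * 1)"
        using s1 by (intro mult_left_mono) auto
      finally show "norm ((norm (F z))\<^sup>2) \<le> norm (m\<^sup>2 * norm (source A s z))" by (simp add: abs_mult)
    qed
  qed measurable
  then show ?thesis unfolding F_def by (simp add: L2_def)
qed

text \<open>
  The pointwise decay of the wave is balanced against the size of \<open>W\<close>. Put
  \<open>w = \<bar>W x\<bar>\<close> and \<open>T = spread t\<close>, and let \<open>b \<le> 1\<close> be the Gaussian factor. Up to a constant,
  \<open>w\<^sup>2 \<bar>wave\<bar>\<^sup>2 \<le> w\<^sup>2 T\<^bsup>-d\<^esup> b\<close>. Where \<open>w T \<ge> 1\<close>, the factor \<open>(w T)\<^bsup>d-2\<^esup> \<ge> 1\<close> can be inserted, which gives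
  \<open>T\<^bsup>-2\<^esup> w\<^bsup>d\<^esup>\<close>; where \<open>w T \<le> 1\<close>, one has \<open>w\<^sup>2 \<le> T\<^bsup>-2\<^esup>\<close>, which gives \<open>T\<^bsup>-d-2\<^esup> b\<close>. Both bounds
  are integrable in space-time.
\<close>

lemma weighted_wave_in_L2:
  fixes W :: "real ^ 'n \<Rightarrow> complex"
  assumes d: "CARD('n) \<ge> 2"
    and W[measurable]: "W \<in> borel_measurable lborel"
    and iW: "integrable lborel (\<lambda>x. norm (W x) ^ CARD('n))"
    and A: "A \<in> sets borel" "A \<subseteq> cball 0 R"
  shows "(\<lambda>z. cnj (W (snd z)) * wave A z) \<in> L2"
proof -
  let ?d = "CARD('n)"
  define C where "C = (pi * measure lborel A)\<^sup>2 * pi ^ ?d * exp (R\<^sup>2 / 2)"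
  have C0: "C \<ge> 0" by (simp add: C_def)
  have fin: "emeasure lborel A < \<infinity>"
    using A by (intro emeasure_bounded_finite bounded_subset[OF bounded_cball])
  have [measurable]: "wave A \<in> borel_measurable borel"
  proof -
    have [measurable]: "profile A \<in> borel_measurable borel"
      using integrable_profile(1)[OF A(1) fin] by (auto dest: borel_measurable_integrable)
    have "(\<lambda>z::real \<times> (real ^ 'n). LINT \<xi>|lborel. cis (snd z \<bullet> \<xi> - fst z * (norm \<xi>)\<^sup>2) * profile A \<xi>) \<in> borel_measurable borel"
      unfolding borel_prod[symmetric] by measurable
    then show ?thesis
      by (simp add: wave_eq_restr_adj[OF A(1) fin] restr_adj_def split_beta')
  qed
  have [measurable]: "(\<lambda>z::real \<times> (real ^ 'n). W (snd z)) \<in> borel_measurable borel"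
    using W unfolding borel_prod[symmetric] by measurable
  have i1: "integrable lborel (\<lambda>z::real \<times> (real^'n). 1 / (spread (fst z))\<^sup>2 * norm (W (snd z)) ^ ?d)"
    by (rule integrable_tensor[OF integrable_inverse_spread_sq iW])
  have i2: "integrable lborel (\<lambda>z::real \<times> (real^'n).
     1 / spread (fst z) ^ (?d + 2) * exp (- (1 / (4 * (spread (fst z))\<^sup>2) * (norm (snd z))\<^sup>2)))"
    using integrable_spreading_gaussian[where 'a = "real^'n"] by simp
  have key: "w\<^sup>2 * (1 / T ^ ?d * b) \<le> 1 / T\<^sup>2 * w ^ ?d + 1 / T ^ (?d + 2) * b"
    if w: "w \<ge> 0" and T: "T > 0" and b: "0 \<le> b" "b \<le> 1" for w T b :: real
  proof (cases "w * T \<ge> 1")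
    case True
    have dd: "?d = (?d - 2) + 2" using d by simp
    have "w\<^sup>2 * (1 / T ^ ?d * b) \<le> w\<^sup>2 * (1 / T ^ ?d * 1)"
      using w T b by (intro mult_left_mono) auto
    also have "\<dots> \<le> w\<^sup>2 * (1 / T ^ ?d * (w * T) ^ (?d - 2))"
      using w T True by (intro mult_left_mono one_le_power) auto
    also have "\<dots> = 1 / T\<^sup>2 * w ^ ?d"
      using T by (subst (1 3) dd) (simp add: power_add power_mult_distrib power2_eq_square field_simps)
    finally show ?thesis using w T b by (simp add: add_increasing2)
  next
    case False
    then have "w \<le> 1 / T" using T by (simp add: field_simps)
    then have "w\<^sup>2 \<le> (1 / T)\<^sup>2" using w by (intro power_mono)
    then have "w\<^sup>2 * (1 / T ^ ?d * b) \<le> (1 / T)\<^sup>2 * (1 / T ^ ?d * b)"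
      using T b by (intro mult_right_mono) auto
    also have "\<dots> = 1 / T ^ (?d + 2) * b" by (simp add: power_add power_divide power2_eq_square mult_ac)
    finally show ?thesis using w T b by (simp add: add_increasing)
  qed
  have "integrable lborel (\<lambda>z. (norm (cnj (W (snd z)) * wave A z))\<^sup>2)"
  proof (rule Bochner_Integration.integrable_bound[OF integrable_mult_right[OF Bochner_Integration.integrable_add[OF i1 i2], of C]])
    show "(\<lambda>z. (norm (cnj (W (snd z)) * wave A z))\<^sup>2) \<in> borel_measurable lborel" using W by measurable
    show "AE z in lborel. norm ((norm (cnj (W (snd z)) * wave A z))\<^sup>2) \<le>
      norm (C * (1 / (spread (fst z))\<^sup>2 * norm (W (snd z)) ^ ?d +
        1 / spread (fst z) ^ (?d + 2) * exp (- (1 / (4 * (spread (fst z))\<^sup>2) * (norm (snd z))\<^sup>2))))"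
      (is "AE z in lborel. _ \<le> norm (C * ?X z)")
    proof (rule AE_I2)
      fix z :: "real \<times> (real^'n)"
      obtain t x where z: "z = (t, x)" by (cases z)
      have tp: "spread t > 0" using spread_ge_1[of t] by linarith
      have "(norm (cnj (W (snd z)) * wave A z))\<^sup>2 = (norm (W x))\<^sup>2 * (norm (wave A (t, x)))\<^sup>2"
        by (simp add: z norm_mult power_mult_distrib)
      also have "\<dots> \<le> (norm (W x))\<^sup>2 * (C * (1 / spread t ^ ?d * exp (- (1 / (4 * (spread t)\<^sup>2) * (norm x)\<^sup>2))))"
        using norm_wave_le[OF A, of t x] by (intro mult_left_mono) (auto simp: C_def)
      also have "\<dots> = C * ((norm (W x))\<^sup>2 * (1 / spread t ^ ?d * exp (- (1 / (4 * (spread t)\<^sup>2) * (norm x)\<^sup>2))))"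
        by (simp only: mult_ac)
      also have "\<dots> \<le> C * ?X z"
        unfolding z fst_conv snd_conv using C0 tp by (intro mult_left_mono key) auto
      finally show "norm ((norm (cnj (W (snd z)) * wave A z))\<^sup>2) \<le> norm (C * ?X z)" by simp
    qed
  qed
  then show ?thesis using W by (auto simp: L2_def)
qed

text \<open>
  The input \<open>1\<^sub>A(x) / W(x) \<cdot> 1/(1 + (t - s)\<^sup>2)\<close> is designed such that multiplication by \<open>W\<close> turns it
  into \<open>source A s\<close>. All integrals that define the output then converge absolutely.
\<close>

lemma source_quotient_wave_in_sandwiched_TS:
  fixes W :: "real ^ 'n \<Rightarrow> complex"
  assumes d: "CARD('n) \<ge> 2"
    and W: "W \<in> borel_measurable lborel"
    and iW: "integrable lborel (\<lambda>x. norm (W x) ^ CARD('n))"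
    and A: "A \<in> sets borel" "A \<subseteq> cball 0 R"
    and m: "m > 0" "\<And>x. x \<in> A \<Longrightarrow> norm (W x) \<ge> 1 / m"
  shows "(\<lambda>z. source A s z / W (snd z), \<lambda>z. cnj (W (snd z)) * wave A ((- s, 0) + z))
      \<in> sandwiched_TS W"
proof -
  have fin: "emeasure lborel A < \<infinity>"
    using A by (intro emeasure_bounded_finite bounded_subset[OF bounded_cball])
  have cancel: "time_indep W z * (source A s z / W (snd z)) = source A s z" for z
  proof (cases "snd z \<in> A")
    case True
    then have "W (snd z) \<noteq> 0" using m(2)[OF True] m(1) by auto
    then show ?thesis by (simp add: time_indep_def split_beta)
  qed (simp add: source_def)
  have extension: "cnj (time_indep W z) * TS (source A s) z = cnj (W (snd z)) * wave A ((- s, 0) + z)" for z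
  proof -
    obtain t x where z: "z = (t, x)" by (cases z)
    show ?thesis unfolding z
      by (simp add: TS_def restr_adj_restr_source[OF A(1) fin] time_indep_def)
  qed
  have rs: "restr (source A s) = (\<lambda>\<xi>. cis (s * (norm \<xi>)\<^sup>2) * profile A \<xi>)"
    by (rule ext) (rule restr_source)
  have [measurable]: "profile A \<in> borel_measurable borel"
    using integrable_profile(1)[OF A(1) fin] by (auto dest: borel_measurable_integrable)
  have meas: "restr (source A s) \<in> borel_measurable borel"
    unfolding rs by measurable
  have "integrable lborel (restr (source A s))"
    by (rule Bochner_Integration.integrable_bound[OF integrable_profile(1)[OF A(1) fin]])
       (use meas in \<open>auto simp: rs norm_mult\<close>)
  moreover have "restr (source A s) \<in> L2"
    using integrable_profile(2)[OF A(1) fin] meas by (simp add: L2_def rs norm_mult)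
  moreover have "(\<lambda>z. cnj (W (snd z)) * wave A ((- s, 0) + z)) \<in> L2"
    using L2_translate[OF weighted_wave_in_L2[OF d W iW A], of "(- s, 0)"] by simp
  ultimately show ?thesis
    using sandwiched_TS_eq[of "\<lambda>z. source A s z / W (snd z)" W]
      source_quotient_in_L2[OF W A(1) fin m] integrable_source[OF A(1) fin]
    unfolding cancel extension by blast
qed

text \<open>
  By the duality of restriction and extension, the inner product of the input
  \<open>1\<^sub>A / (W (1 + t\<^sup>2))\<close> with this function is the squared norm of \<open>profile A\<close>, which is positive.
\<close>

lemma weighted_wave_nonzero:
  fixes W :: "real ^ 'n \<Rightarrow> complex"
  assumes d: "CARD('n) \<ge> 2"
    and W: "W \<in> borel_measurable lborel"
    and iW: "integrable lborel (\<lambda>x. norm (W x) ^ CARD('n))"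
    and A: "A \<in> sets borel" "A \<subseteq> cball 0 R" "emeasure lborel A \<noteq> 0"
    and m: "m > 0" "\<And>x. x \<in> A \<Longrightarrow> norm (W x) \<ge> 1 / m"
  shows "L2_norm (\<lambda>z. cnj (W (snd z)) * wave A z) \<noteq> 0"
proof
  define F where "F z = source A 0 z / W (snd z)" for z
  define H where "H z = cnj (W (snd z)) * wave A z" for z
  have fin: "emeasure lborel A < \<infinity>"
    using A by (intro emeasure_bounded_finite bounded_subset[OF bounded_cball])
  have F: "F \<in> L2" unfolding F_def[abs_def] by (rule source_quotient_in_L2[OF W A(1) fin m])
  have H: "H \<in> L2" unfolding H_def[abs_def] by (rule weighted_wave_in_L2[OF d W iW A(1,2)])
  assume "L2_norm (\<lambda>z. cnj (W (snd z)) * wave A z) = 0"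
  then have "L2_inner F H = 0"
    using L2_Cauchy_Schwarz[OF F H] by (simp add: H_def[abs_def])
  have r0: "restr (source A 0) = profile A" by (rule ext) (simp add: restr_source)
  have "L2_inner (restr (source A 0)) (profile A) = (LINT z|lborel. source A 0 z * cnj (restr_adj (profile A) z))"
    by (rule restr_duality[OF integrable_source[OF A(1) fin] integrable_profile(1)[OF A(1) fin]])
  also have "\<dots> = (LINT z|lborel. F z * cnj (H z))"
  proof (rule Bochner_Integration.integral_cong[OF refl])
    fix z
    have "source A 0 z = F z * W (snd z)"
    proof (cases "snd z \<in> A")
      case True
      then have "W (snd z) \<noteq> 0" using m(2)[OF True] m(1) by auto
      then show ?thesis by (simp add: F_def)
    qed (simp add: F_def source_def)
    then show "source A 0 z * cnj (restr_adj (profile A) z) = F z * cnj (H z)"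
      by (simp add: H_def wave_eq_restr_adj[OF A(1) fin, symmetric])
  qed
  also have "\<dots> = 0" using \<open>L2_inner F H = 0\<close> by (simp add: L2_inner_def)
  finally have "(LINT \<xi>|lborel. profile A \<xi> * cnj (profile A \<xi>)) = 0" by (simp add: r0 L2_inner_def)
  then have "complex_of_real (LINT \<xi>|lborel. (norm (profile A \<xi>))\<^sup>2) = 0"
    by (simp only: complex_norm_square[symmetric] integral_complex_of_real)
  then show False using profile_nonzero[OF A] by simp
qed

section \<open>Non-compactness\<close>

theorem lemma2:
  fixes W :: "real ^ 'n \<Rightarrow> complex"
  assumes "CARD('n) \<ge> 3"
    and "W \<in> borel_measurable lborel"
    and "integrable lborel (\<lambda>x. norm (W x) ^ CARD('n))"
    and "\<not> (AE x in lborel. W x = 0)"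
  shows "\<not> L2_compact (sandwiched_TS W)"
proof
  assume comp: "L2_compact (sandwiched_TS W)"
  have d: "CARD('n) \<ge> 2" using assms(1) by simp
  obtain A m where A: "A \<in> sets borel" "A \<subseteq> cball 0 m" "emeasure lborel A \<noteq> 0"
    and m: "m > 0" "\<And>x. x \<in> A \<Longrightarrow> norm (W x) \<ge> 1 / m"
    using essentially_nonzero_on_bounded_set[OF assms(2,4)] by metis
  have fin: "emeasure lborel A < \<infinity>"
    using A by (intro emeasure_bounded_finite bounded_subset[OF bounded_cball])
  define F where "F n z = source A (real n) z / W (snd z)" for n :: nat and z
  define H where "H z = cnj (W (snd z)) * wave A z" for z
  define shift :: "nat \<Rightarrow> real \<times> (real ^ 'n)" where "shift n = (- real n, 0)" for n
  have H_L2: "H \<in> L2"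
    unfolding H_def[abs_def] by (rule weighted_wave_in_L2[OF d assms(2,3) A(1,2)])
  have pairs: "(F n, \<lambda>z. H (shift n + z)) \<in> sandwiched_TS W" for n
    using source_quotient_wave_in_sandwiched_TS[OF d assms(2,3) A(1,2) m, of "real n"]
    by (simp add: F_def[abs_def] H_def shift_def)
  have "F n = (\<lambda>z. F 0 (shift n + z))" for n
    by (rule ext) (simp add: F_def shift_def source_def)
  moreover have "F 0 \<in> L2"
    unfolding F_def[abs_def] by (rule source_quotient_in_L2[OF assms(2) A(1) fin m])
  ultimately have "L2_norm (F n) = L2_norm (F 0)" for n
    by (metis L2_norm_translate)
  then have bounded: "\<exists>C. \<forall>n. L2_norm (F n) \<le> C" by (intro exI allI eq_refl)
  obtain r H' where r: "strict_mono (r :: nat \<Rightarrow> nat)" and H': "H' \<in> L2"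
    and lim: "L2_tendsto (\<lambda>n. (\<lambda>z. H (shift (r n) + z))) H'"
    using comp[unfolded L2_compact_def, rule_format, of F "\<lambda>n z. H (shift n + z)"] pairs bounded
    by blast
  have "(\<lambda>n. L2_norm (\<lambda>z. H (shift (r n) + z))) \<longlonglongrightarrow> 0"
  proof (rule L2_tendsto_pointwise_zero[OF L2_translate[OF H_L2] H' lim])
    fix z :: "real \<times> (real ^ 'n)"
    have "(\<lambda>n. cnj (W (snd z)) * wave A (fst z - real n, snd z)) \<longlonglongrightarrow> 0"
      by (intro tendsto_mult_right_zero wave_tendsto_zero[OF A(1,2)])
    moreover have "shift n + z = (fst z - real n, snd z)" for n
      by (cases z) (simp add: shift_def)
    ultimately have "(\<lambda>n. H (shift n + z)) \<longlonglongrightarrow> 0" by (simp add: H_def)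
    from LIMSEQ_subseq_LIMSEQ[OF this r] show "(\<lambda>n. H (shift (r n) + z)) \<longlonglongrightarrow> 0"
      by (simp add: o_def)
  qed
  then have "L2_norm H = 0"
    by (simp add: L2_norm_translate[OF H_L2] LIMSEQ_const_iff)
  then show False
    using weighted_wave_nonzero[OF d assms(2,3) A m] unfolding H_def[abs_def] by simp
qed

end
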